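(* For each $A\in M_n(\mathbb{Z}_+)$ there is a unique element $b(A)\in\mathcal{O}_{q,P,Q}(M(n))$ characterized by the following two properties: (1) $b(A)=Z(A)+\sum_{B}h_{AB}Z(B)$, where the sum is over $B\in M_n(\mathbb{Z}_+)$ with $B\neq A$, each $h_{AB}$ lies in $\mathbb{Z}[\Gamma_+]$, and $h_{AB}\neq 0$ only if $B\le A$; (2) $\overline{b(A)}=b(A)$. Moreover, the set $B^*=\{b(A)\mid A\in M_n(\mathbb{Z}_+)\}$ is a $K$-basis of the algebra $\mathcal{O}_{q,P,Q}(M(n))$, where $K=\mathbb{Q}(q,p_{ij},q_{ij}\mid i<j)$.
   Context: Let $n\ge 1$, $\mathbb{Z}_+=\{0,1,2,\dots\}$. Let $q$, $p_{ij}$, $q_{ij}$ ($1\le i<j\le n$) be independent variables, $K=\mathbb{Q}(q,p_{ij},q_{ij}\mid i<j)$, and set $p_{ii}=q_{ii}=1$, $p_{ji}=p_{ij}^{-1}$, $q_{ji}=q_{ij}^{-1}$. The algebra $\mathcal{O}_{q,P,Q}(M(n))$ is the associative unital $K$-algebra with generators $Z_{ij}$ ($1\le i,j\le n$) and relations $Z_{st}Z_{ij}=p_{si}^2q_{tj}^2Z_{ij}Z_{st}+(q^2-1)p_{si}^2Z_{it}Z_{sj}$ if $s>i,\ t>j$; $Z_{st}Z_{ij}=q^2p_{si}^2q_{jt}^{-2}Z_{ij}Z_{st}$ if $s>i,\ t\le j$; $Z_{it}Z_{ij}=q_{tj}^2Z_{ij}Z_{it}$ for all $i,j,t$. The bar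 action $x\mapsto\overline{x}$ is the $\mathbb{Q}$-algebra anti-automorphism of $\mathcal{O}_{q,P,Q}(M(n))$ with $\overline{Z_{ij}}=Z_{ij}$, $\overline{q}=q^{-1}$, $\overline{p_{ij}}=p_{ji}$, $\overline{q_{ij}}=q_{ji}$. For $A=(a_{ij})\in M_n(\mathbb{Z}_+)$ let $Z^A=\prod Z_{ij}^{a_{ij}}$ with factors in increasing lexicographic order of $(i,j)$; these monomials form a $K$-basis. The normalized monomial is $Z(A)=D(A)Z^A$, where $$D(A)=q^{\sum_{s>i,\,t\le j}a_{st}a_{ij}}\prod_{s>i}p_{si}^{a_{st}a_{ij}}\prod_{t>j,\,s\ge i}q_{tj}^{a_{st}a_{ij}}\prod_{s>i,\,j>t}q_{jt}^{-a_{st}a_{ij}}$$ (each sum/product is over all pairs of index pairs $(s,t),(i,j)$ satisfying the indicated conditions). For $A,B\in M_n(\mathbb{Z}_+)$, $B\le A$ means that $B$ is obtained from $A$ by a (possibly empty) sequence of moves, each of which picks $i<s$, $j<t$ with $a_{ij},a_{st}\ge1$, decreases the $(i,j)$ and $(s,t)$ entries by $1$, increases the $(i,t)$ and $(s,j)$ entries by $1$, and leaves all other entries unchanged. $\Gamma$ is the (free abelian) subgroup of $K^*$ generated by $q,p_{ij},q_{ij}$ ($i<j$), totally ordered by the lexicographic order, compatible with the group structure, determined by $q<p_{ij}<q_{st}<1$ for $i<j$, $s<t$; that is, listing the generators as $q$, then the $p_{ij}$, then the $q_{ij}$ (in some fixed order within each family), an element $\gamma\neq1$ is $<1$ if and only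 if its first nonzero exponent in this list is positive. $\Gamma_+$ is the set of strictly positive elements, i.e. those $>1$ (so $q^{-1}\in\Gamma_+$), and $\mathbb{Z}[\Gamma_+]$ is the set of $\mathbb{Z}$-linear combinations of elements of $\Gamma_+$. *)

theory Defs
  imports Complex_Main "HOL-Library.Poly_Mapping" "HOL-Computational_Algebra.Fraction_Field"
begin

text \<open>
  A finite linearly ordered index type \<open>'n\<close> plays the role of \<open>{1, \<dots>, n}\<close>, \<open>n \<ge> 1\<close>.
\<close>

datatype 'n raw_param = RawQ | RawP 'n 'n | RawR 'n 'n

fun raw_le :: "'n::linorder raw_param \<Rightarrow> 'n raw_param \<Rightarrow> bool" where
  "raw_le RawQ _ = True"
| "raw_le (RawP i j) RawQ = False"
| "raw_le (RawP i j) (RawP k l) = (i < k \<or> i = k \<and> j \<le> l)"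
| "raw_le (RawP i j) (RawR k l) = True"
| "raw_le (RawR i j) RawQ = False"
| "raw_le (RawR i j) (RawP k l) = False"
| "raw_le (RawR i j) (RawR k l) = (i < k \<or> i = k \<and> j \<le> l)"

text \<open>The variables are exactly \<open>q\<close>, and \<open>p_ij\<close>, \<open>q_ij\<close> with \<open>i < j\<close>
  (the family \<open>q_ij\<close> carries the letter \<open>R\<close>, \<open>r\<close> to keep it apart from \<open>q\<close>).\<close>

typedef (overloaded) 'n param =
  "{RawQ} \<union> {RawP i j | i j. i < j} \<union> {RawR i j | i j. (i::'n::linorder) < j}"
  by blast

text \<open>A linear order on the variables is needed only because the integral domain instance
  of \<open>poly_mapping\<close> asks for it; it is unrelated to the order on \<open>\<Gamma>\<close> below.\<close>

instantiation param :: (linorder) linorder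
begin

definition less_eq_param :: "'a param \<Rightarrow> 'a param \<Rightarrow> bool" where
  "less_eq_param x y = raw_le (Rep_param x) (Rep_param y)"

definition less_param :: "'a param \<Rightarrow> 'a param \<Rightarrow> bool" where
  "less_param x y \<longleftrightarrow> x \<le> y \<and> \<not> y \<le> x"

instance
proof
  have refl: "raw_le a a" for a :: "'a raw_param" by (cases a) auto
  have trans: "raw_le a b \<Longrightarrow> raw_le b c \<Longrightarrow> raw_le a c" for a b c :: "'a raw_param"
    by (cases a; cases b; cases c) auto
  have anti: "raw_le a b \<Longrightarrow> raw_le b a \<Longrightarrow> a = b" for a b :: "'a raw_param"
    by (cases a; cases b) auto
  have tot: "raw_le a b \<or> raw_le b a" for a b :: "'a raw_param"
    by (cases a; cases b) auto
  fix x y z :: "'a param"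
  show "x < y \<longleftrightarrow> x \<le> y \<and> \<not> y \<le> x" by (rule less_param_def)
  show "x \<le> x" by (simp add: less_eq_param_def refl)
  show "x \<le> y \<Longrightarrow> y \<le> z \<Longrightarrow> x \<le> z" unfolding less_eq_param_def by (rule trans)
  show "x \<le> y \<Longrightarrow> y \<le> x \<Longrightarrow> x = y"
    unfolding less_eq_param_def using anti Rep_param_inject by blast
  show "x \<le> y \<or> y \<le> x" unfolding less_eq_param_def by (rule tot)
qed

end

instance param :: ("{finite, linorder}") finite
proof
  have "(UNIV :: 'a raw_param set)
      \<subseteq> {RawQ} \<union> (\<lambda>(i, j). RawP i j) ` UNIV \<union> (\<lambda>(i, j). RawR i j) ` UNIV"
  proof
    fix x :: "'a raw_param"
    show "x \<in> {RawQ} \<union> (\<lambda>(i, j). RawP i j) ` UNIV \<union> (\<lambda>(i, j). RawR i j) ` UNIV"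
      by (cases x) auto
  qed
  then have fin: "finite (UNIV :: 'a raw_param set)"
    by (rule finite_subset) simp
  have "inj (Rep_param :: 'a param \<Rightarrow> _)" by (simp add: inj_def Rep_param_inject)
  then show "finite (UNIV :: 'a param set)"
    by (meson fin finite_imageD finite_subset subset_UNIV)
qed

type_synonym 'n ratfun = "(('n param \<Rightarrow>\<^sub>0 nat) \<Rightarrow>\<^sub>0 rat) fract"

instance fract :: ("{idom, ring_char_0}") field_char_0
proof
  have "of_nat n = Fract (of_nat n :: 'a) 1" for n
    by (induction n) (simp_all add: Zero_fract_def One_fract_def)
  then show "inj (of_nat :: nat \<Rightarrow> 'a fract)"
    by (auto simp: inj_def eq_fract)
qed

definition paramQ :: "'n::linorder param" where
  "paramQ = Abs_param RawQ"

definition paramP :: "'n::linorder \<Rightarrow> 'n \<Rightarrow> 'n param" where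
  "paramP i j = Abs_param (RawP i j)"

definition paramR :: "'n::linorder \<Rightarrow> 'n \<Rightarrow> 'n param" where
  "paramR i j = Abs_param (RawR i j)"

definition Kvar :: "'n::linorder param \<Rightarrow> 'n ratfun" where
  "Kvar v = Fract (Poly_Mapping.single (Poly_Mapping.single v 1) 1) 1"

definition kq :: "'n::linorder ratfun" where
  "kq = Kvar paramQ"

definition kp :: "'n::linorder \<Rightarrow> 'n \<Rightarrow> 'n ratfun" where
  "kp i j = (if i < j then Kvar (paramP i j)
             else if j < i then inverse (Kvar (paramP j i)) else 1)"

definition kr :: "'n::linorder \<Rightarrow> 'n \<Rightarrow> 'n ratfun" where
  "kr i j = (if i < j then Kvar (paramR i j)
             else if j < i then inverse (Kvar (paramR j i)) else 1)"

text \<open>Noncommutative monomials: words, written additively since the product of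
  \<open>poly_mapping\<close> is the convolution over an additive monoid.\<close>

datatype 'a ncmon = NCMon "'a list"

instantiation ncmon :: (type) monoid_add
begin

definition zero_ncmon :: "'a ncmon" where
  "zero_ncmon = NCMon []"

fun plus_ncmon :: "'a ncmon \<Rightarrow> 'a ncmon \<Rightarrow> 'a ncmon" where
  "plus_ncmon (NCMon u) (NCMon v) = NCMon (u @ v)"

instance
proof
  fix a b c :: "'a ncmon"
  show "a + b + c = a + (b + c)" by (cases a; cases b; cases c) simp
  show "0 + a = a" by (cases a) (simp add: zero_ncmon_def)
  show "a + 0 = a" by (cases a) (simp add: zero_ncmon_def)
qed

end

type_synonym 'n free_alg = "('n \<times> 'n) ncmon \<Rightarrow>\<^sub>0 'n ratfun"

definition fZ :: "'n::linorder \<Rightarrow> 'n \<Rightarrow> 'n free_alg" where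
  "fZ i j = Poly_Mapping.single (NCMon [(i, j)]) 1"

definition fconst :: "'n::linorder ratfun \<Rightarrow> 'n free_alg" where
  "fconst c = Poly_Mapping.single 0 c"

definition relators :: "'n::linorder free_alg set" where
  "relators =
     {fZ s t * fZ i j
        - (fconst ((kp s i)\<^sup>2 * (kr t j)\<^sup>2) * fZ i j * fZ s t
           + fconst ((kq\<^sup>2 - 1) * (kp s i)\<^sup>2) * fZ i t * fZ s j)
       | s t i j. s > i \<and> t > j}
   \<union> {fZ s t * fZ i j
        - fconst (kq\<^sup>2 * (kp s i)\<^sup>2 * inverse ((kr j t)\<^sup>2)) * fZ i j * fZ s t
       | s t i j. s > i \<and> t \<le> j}
   \<union> {fZ i t * fZ i j - fconst ((kr t j)\<^sup>2) * fZ i j * fZ i t | i j t. True}"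

inductive_set two_sided_ideal :: "'a::ring_1 set \<Rightarrow> 'a set" for R where
  zero: "0 \<in> two_sided_ideal R"
| gen: "r \<in> R \<Longrightarrow> a * r * b \<in> two_sided_ideal R"
| add: "x \<in> two_sided_ideal R \<Longrightarrow> y \<in> two_sided_ideal R \<Longrightarrow> x + y \<in> two_sided_ideal R"

lemma two_sided_ideal_mult:
  assumes "x \<in> two_sided_ideal R"
  shows "a * x * b \<in> two_sided_ideal R"
  using assms
proof induction
  case zero
  show ?case by (simp add: two_sided_ideal.zero)
next
  case (gen r c d)
  have "a * (c * r * d) * b = (a * c) * r * (d * b)" by (simp add: mult.assoc)
  then show ?case using gen by (metis two_sided_ideal.gen)
next
  case (add x y)
  then show ?case by (simp add: distrib_left distrib_right two_sided_ideal.add)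
qed

lemma two_sided_ideal_uminus:
  "x \<in> two_sided_ideal R \<Longrightarrow> - x \<in> two_sided_ideal R"
  using two_sided_ideal_mult[of x R "- 1" 1] by simp

lemma two_sided_ideal_left: "x \<in> two_sided_ideal R \<Longrightarrow> a * x \<in> two_sided_ideal R"
  using two_sided_ideal_mult[of x R a 1] by simp

lemma two_sided_ideal_right: "x \<in> two_sided_ideal R \<Longrightarrow> x * b \<in> two_sided_ideal R"
  using two_sided_ideal_mult[of x R 1 b] by simp

definition cong_rel :: "'n::linorder free_alg \<Rightarrow> 'n free_alg \<Rightarrow> bool" where
  "cong_rel x y \<longleftrightarrow> x - y \<in> two_sided_ideal relators"

lemma equivp_cong_rel: "equivp (cong_rel :: 'n::linorder free_alg \<Rightarrow> _)"
proof (rule equivpI)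
  show "reflp (cong_rel :: 'n free_alg \<Rightarrow> _)" by (simp add: reflp_def cong_rel_def two_sided_ideal.zero)
  show "symp (cong_rel :: 'n free_alg \<Rightarrow> _)"
  proof (rule sympI)
    fix x y :: "'n free_alg"
    assume "cong_rel x y"
    then show "cong_rel y x"
      using two_sided_ideal_uminus[of "x - y"] by (simp add: cong_rel_def)
  qed
  show "transp (cong_rel :: 'n free_alg \<Rightarrow> _)"
  proof (rule transpI)
    fix x y z :: "'n free_alg"
    assume "cong_rel x y" "cong_rel y z"
    then show "cong_rel x z"
      using two_sided_ideal.add[of "x - y" _ "y - z"] by (simp add: cong_rel_def)
  qed
qed

quotient_type (overloaded) 'n qmat = "'n::linorder free_alg" / cong_rel
  by (rule equivp_cong_rel)

lemma ncmon_add_eq_0_iff: "u + v = 0 \<longleftrightarrow> u = 0 \<and> v = (0 :: 'a ncmon)"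
  by (cases u; cases v) (simp add: zero_ncmon_def)

lemma lookup_mult_empty:
  fixes f g :: "'a ncmon \<Rightarrow>\<^sub>0 'b::semiring_0"
  shows "Poly_Mapping.lookup (f * g) 0 = Poly_Mapping.lookup f 0 * Poly_Mapping.lookup g 0"
proof -
  have "Poly_Mapping.lookup (f * g) 0
      = Sum_any (\<lambda>l. Poly_Mapping.lookup f l * Sum_any (\<lambda>m. Poly_Mapping.lookup g m when l = 0 \<and> m = 0))"
    unfolding lookup_mult
    by (simp add: ncmon_add_eq_0_iff[symmetric] eq_commute[of "0 :: 'a ncmon" "_ + _"])
  also have "\<dots> = Sum_any (\<lambda>l. (Poly_Mapping.lookup f l * Poly_Mapping.lookup g 0 when l = 0))"
    by (rule Sum_any.cong) (auto simp: when_def)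
  finally show ?thesis by simp
qed

lemma lookup_two_sided_ideal_empty:
  assumes "x \<in> two_sided_ideal (relators :: 'n::linorder free_alg set)"
  shows "Poly_Mapping.lookup x 0 = 0"
  using assms
proof induction
  case zero
  show ?case by simp
next
  case (gen r a b)
  have "Poly_Mapping.lookup (fZ i j) 0 = 0" for i j :: 'n
    by (simp add: fZ_def lookup_single zero_ncmon_def)
  then have "Poly_Mapping.lookup r 0 = 0"
    using gen by (auto simp: relators_def lookup_minus lookup_add lookup_mult_empty)
  then show ?case by (simp add: lookup_mult_empty)
next
  case (add x y)
  then show ?case by (simp add: lookup_add)
qed

instantiation qmat :: (linorder) ring_1
begin

lift_definition zero_qmat :: "'a qmat" is 0 .
lift_definition one_qmat :: "'a qmat" is 1 .

lift_definition plus_qmat :: "'a qmat \<Rightarrow> 'a qmat \<Rightarrow> 'a qmat" is "(+)"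
proof -
  fix x y u v :: "'a free_alg"
  assume "cong_rel x y" "cong_rel u v"
  then show "cong_rel (x + u) (y + v)"
    using two_sided_ideal.add[of "x - y" _ "u - v"] by (simp add: cong_rel_def algebra_simps)
qed

lift_definition uminus_qmat :: "'a qmat \<Rightarrow> 'a qmat" is uminus
proof -
  fix x y :: "'a free_alg"
  assume "cong_rel x y"
  then show "cong_rel (- x) (- y)"
    using two_sided_ideal_uminus[of "x - y"] by (simp add: cong_rel_def)
qed

definition minus_qmat :: "'a qmat \<Rightarrow> 'a qmat \<Rightarrow> 'a qmat" where
  "minus_qmat x y = x + (- y)"

lift_definition times_qmat :: "'a qmat \<Rightarrow> 'a qmat \<Rightarrow> 'a qmat" is "(*)"
proof -
  fix x y u v :: "'a free_alg"
  assume "cong_rel x y" "cong_rel u v"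
  then have "(x - y) * u + y * (u - v) \<in> two_sided_ideal relators"
    unfolding cong_rel_def
    by (intro two_sided_ideal.add two_sided_ideal_left two_sided_ideal_right)
  then show "cong_rel (x * u) (y * v)" by (simp add: cong_rel_def algebra_simps)
qed

instance
proof
  have eq: "x = y \<Longrightarrow> cong_rel x y" for x y :: "'a free_alg"
    by (simp add: equivp_reflp[OF equivp_cong_rel])
  fix a b c :: "'a qmat"
  show "a + b + c = a + (b + c)" by transfer (rule eq, simp add: add.assoc)
  show "a + b = b + a" by transfer (rule eq, simp add: add.commute)
  show "0 + a = a" by transfer (rule eq, simp)
  show "- a + a = 0" by transfer (rule eq, simp)
  show "a - b = a + - b" by (rule minus_qmat_def)
  show "a * b * c = a * (b * c)" by transfer (rule eq, simp add: mult.assoc)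
  show "(a + b) * c = a * c + b * c" by transfer (rule eq, simp add: distrib_right)
  show "a * (b + c) = a * b + a * c" by transfer (rule eq, simp add: distrib_left)
  show "1 * a = a" by transfer (rule eq, simp)
  show "a * 1 = a" by transfer (rule eq, simp)
  show "(0 :: 'a qmat) \<noteq> 1"
  proof transfer
    show "\<not> cong_rel (0 :: 'a free_alg) 1"
      using lookup_two_sided_ideal_empty[of "0 - 1 :: 'a free_alg"]
      by (auto simp: cong_rel_def lookup_minus lookup_one)
  qed
qed

end

lift_definition Zgen :: "'n::linorder \<Rightarrow> 'n \<Rightarrow> 'n qmat" is fZ .

lift_definition Kconst :: "'n::linorder ratfun \<Rightarrow> 'n qmat" is fconst .

definition Kscale :: "'n::linorder ratfun \<Rightarrow> 'n qmat \<Rightarrow> 'n qmat" where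
  "Kscale c x = Kconst c * x"

lemma vector_space_Kscale: "vector_space (Kscale :: 'n::linorder ratfun \<Rightarrow> _)"
proof
  have eq: "x = y \<Longrightarrow> cong_rel x y" for x y :: "'n free_alg"
    by (simp add: equivp_reflp[OF equivp_cong_rel])
  have add: "Kconst (a + b) = Kconst a + Kconst b" for a b :: "'n ratfun"
    by transfer (rule eq, simp add: fconst_def single_add)
  have mult: "Kconst (a * b) = Kconst a * Kconst b" for a b :: "'n ratfun"
    by transfer (rule eq, simp add: fconst_def mult_single)
  have one: "Kconst 1 = (1 :: 'n qmat)"
    by transfer (rule eq, simp add: fconst_def)
  fix a b :: "'n ratfun" and x y :: "'n qmat"
  show "Kscale a (x + y) = Kscale a x + Kscale a y" by (simp add: Kscale_def distrib_left)
  show "Kscale (a + b) x = Kscale a x + Kscale b x" by (simp add: Kscale_def add distrib_right)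
  show "Kscale a (Kscale b x) = Kscale (a * b) x" by (simp add: Kscale_def mult mult.assoc)
  show "Kscale 1 x = x" by (simp add: Kscale_def one)
qed

definition is_K_basis :: "'n::linorder qmat set \<Rightarrow> bool" where
  "is_K_basis S \<longleftrightarrow> \<not> module.dependent Kscale S \<and> module.span Kscale S = UNIV"

definition is_bar :: "('n::linorder qmat \<Rightarrow> 'n qmat) \<Rightarrow> bool" where
  "is_bar f \<longleftrightarrow>
     bij f \<and>
     (\<forall>x y. f (x + y) = f x + f y) \<and>
     (\<forall>r x. f (Kscale (of_rat r) x) = Kscale (of_rat r) (f x)) \<and>
     f 1 = 1 \<and>
     (\<forall>x y. f (x * y) = f y * f x) \<and>
     (\<forall>i j. f (Zgen i j) = Zgen i j) \<and>
     f (Kconst kq) = Kconst (inverse kq) \<and>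
     (\<forall>i j. f (Kconst (kp i j)) = Kconst (kp j i)) \<and>
     (\<forall>i j. f (Kconst (kr i j)) = Kconst (kr j i))"

text \<open>The anti-automorphism with the listed values is unique because \<open>K\<close> is generated, as a
  field, by the parameters, and it exists because inverting the parameters and reversing words
  preserves the defining relations.\<close>

definition bar :: "'n::linorder qmat \<Rightarrow> 'n qmat" where
  "bar = (THE f. is_bar f)"

type_synonym 'n nmat = "'n \<Rightarrow> 'n \<Rightarrow> nat"

text \<open>\<open>List.product I I\<close> lists the index pairs in increasing lexicographic order.\<close>

definition Zmon :: "'n::{finite, linorder} nmat \<Rightarrow> 'n qmat" where
  "Zmon A =
     (let I = sorted_list_of_set UNIV
      in prod_list (map (\<lambda>(i, j). Zgen i j ^ A i j) (List.product I I)))"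

definition Dfactor :: "'n::{finite, linorder} nmat \<Rightarrow> 'n ratfun" where
  "Dfactor A =
     kq ^ (\<Sum>(s, t, i, j) \<in> {(s, t, i, j). s > i \<and> t \<le> j}. A s t * A i j)
   * (\<Prod>(s, t, i, j) \<in> {(s, t, i, j). s > i}. kp s i ^ (A s t * A i j))
   * (\<Prod>(s, t, i, j) \<in> {(s, t, i, j). t > j \<and> s \<ge> i}. kr t j ^ (A s t * A i j))
   * (\<Prod>(s, t, i, j) \<in> {(s, t, i, j). s > i \<and> j > t}. kr j t powi (- int (A s t * A i j)))"

definition Znorm :: "'n::{finite, linorder} nmat \<Rightarrow> 'n qmat" where
  "Znorm A = Kscale (Dfactor A) (Zmon A)"

definition move :: "'n::linorder nmat \<Rightarrow> 'n nmat \<Rightarrow> bool" where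
  "move A B \<longleftrightarrow>
     (\<exists>i s j t. i < s \<and> j < t \<and> A i j \<ge> 1 \<and> A s t \<ge> 1 \<and>
        B = (\<lambda>k l. if (k, l) = (i, j) \<or> (k, l) = (s, t) then A k l - 1
                   else if (k, l) = (i, t) \<or> (k, l) = (s, j) then A k l + 1
                   else A k l))"

definition mat_le :: "'n::linorder nmat \<Rightarrow> 'n nmat \<Rightarrow> bool" where
  "mat_le B A \<longleftrightarrow> move\<^sup>*\<^sup>* A B"

text \<open>A listing of the generators: \<open>q\<close> first, then the \<open>p_ij\<close>, then the \<open>q_ij\<close>, in an
  arbitrary order within the last two families.\<close>

definition admissible_listing :: "'n::linorder param list \<Rightarrow> bool" where
  "admissible_listing L \<longleftrightarrow>
     (\<exists>ps rs. L = paramQ # ps @ rs \<and> distinct L \<and>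
        set ps = {paramP i j | i j. i < j} \<and> set rs = {paramR i j | i j. i < j})"

definition Gmon :: "('n::{finite, linorder} param \<Rightarrow> int) \<Rightarrow> 'n ratfun" where
  "Gmon e = (\<Prod>v\<in>UNIV. Kvar v powi e v)"

definition Gamma :: "'n::{finite, linorder} ratfun set" where
  "Gamma = {Gmon e | e. True}"

text \<open>\<open>Gmon\<close> is injective, so the exponent vector \<open>e\<close> below is determined by \<open>g\<close>.\<close>

definition below_one :: "'n::{finite, linorder} param list \<Rightarrow> 'n ratfun \<Rightarrow> bool" where
  "below_one L g \<longleftrightarrow>
     (\<exists>e. g = Gmon e \<and> (\<exists>k < length L. e (L ! k) > 0 \<and> (\<forall>l < k. e (L ! l) = 0)))"

definition Gamma_less :: "'n::{finite, linorder} param list \<Rightarrow> 'n ratfun \<Rightarrow> 'n ratfun \<Rightarrow> bool" where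
  "Gamma_less L g h \<longleftrightarrow> g \<in> Gamma \<and> h \<in> Gamma \<and> below_one L (g / h)"

definition Gamma_plus :: "'n::{finite, linorder} param list \<Rightarrow> 'n ratfun set" where
  "Gamma_plus L = {g \<in> Gamma. Gamma_less L 1 g}"

definition Z_Gamma_plus :: "'n::{finite, linorder} param list \<Rightarrow> 'n ratfun set" where
  "Z_Gamma_plus L =
     {\<Sum>g\<in>S. of_int (c g) * g | S c. finite S \<and> S \<subseteq> Gamma_plus L}"

text \<open>The value \<open>h A\<close> is irrelevant.  Finiteness of the support
  already follows from the order condition; it is spelled out because an infinite \<open>sum\<close> is \<open>0\<close>.\<close>

definition is_canonical ::
  "'n::{finite, linorder} param list \<Rightarrow> 'n nmat \<Rightarrow> 'n qmat \<Rightarrow> bool" where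
  "is_canonical L A b \<longleftrightarrow>
     (\<exists>h. (\<forall>B. B \<noteq> A \<longrightarrow> h B \<in> Z_Gamma_plus L) \<and>
          (\<forall>B. B \<noteq> A \<longrightarrow> h B \<noteq> 0 \<longrightarrow> mat_le B A) \<and>
          finite {B. B \<noteq> A \<and> h B \<noteq> 0} \<and>
          b = Znorm A + (\<Sum>B \<in> {B. B \<noteq> A \<and> h B \<noteq> 0}. Kscale (h B) (Znorm B))) \<and>
     bar b = b"

definition canonical_elem ::
  "'n::{finite, linorder} param list \<Rightarrow> 'n nmat \<Rightarrow> 'n qmat" where
  "canonical_elem L A = (THE b. is_canonical L A b)"

end

theory Submission
  imports Defs "HOL-Library.Product_Lexorder" "HOL-Library.Multiset"
begin

text \<open>
  Linear independence of the monomials: after a cocycle twist removing the parameters \<open>p_ij\<close>,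
  \<open>q_ij\<close>, moving a generator to the right through a complete row is given by explicit operators on
  the exponents of that row.  Composing them row by row makes the free algebra act from the right on
  functions of matrices, the relations hold by induction on the number of rows, and evaluating the
  action on indicator functions produces coordinate functionals.

  A word in the generators is normalized by a monomial in the parameters so that exchanging two
  adjacent letters changes it only by words of smaller content, while the bar action just reverses
  it.  Hence \<open>bar\<close> is unitriangular on the \<open>Z(A)\<close> with entries in \<open>\<int>[\<Gamma>]\<close>, and Lusztig's lemma applies:
  an element of \<open>\<int>[\<Gamma>]\<close> which bar sends to its negative is \<open>h - bar h\<close> for some \<open>h \<in> \<int>[\<Gamma>\<^sub>+]\<close>, and \<open>\<int>[\<Gamma>\<^sub>+]\<close>
  contains no nonzero bar-invariant element.
\<close>

section \<open>The bar involution on the field of rational functions\<close>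

text \<open>Independence of the ordered monomials cannot be read off from the presentation, and
  normal forms of words would call for a confluence argument. Hence a module is built. Transposed
  operators act on all functions of exponent matrices, so no finite supports have to be maintained,
  and associativity is composition. Peeling off row 0 turns a relation between two later rows into
  the same relation one row further down; what remains are identities between coefficients for a
  single row.

  Totality of the order on \<open>Gamma\<close> makes \<open>ZGamma\<close> the direct sum of the
  span of \<open>Gamma_plus\<close>, the integers and the bar image of that span. Anti-invariance
  kills the middle summand, since 2n = 0 forces n = 0.

  Induction on matrices uses the sum of i * j * a_ij with indices counted from 0: a move lowers it
  by (s - i) * (t - j) > 0. So \<open>mat_le\<close> is antisymmetric, and its lower sets are finite
  because moves keep the sum of the entries.

  As \<open>bar\<close> is given by a definite description, it has to be constructed and shown
  unique; on scalars this uses that the parameters generate the field.\<close>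

definition pm_lift :: "('a \<Rightarrow> 'b \<Rightarrow> 'c) \<Rightarrow> ('a \<Rightarrow>\<^sub>0 'b::zero) \<Rightarrow> 'c::comm_monoid_add" where
  "pm_lift g p = (\<Sum>k\<in>Poly_Mapping.keys p. g k (Poly_Mapping.lookup p k))"

lemma pm_lift_zero [simp]: "pm_lift g 0 = 0"
  by (simp add: pm_lift_def)

lemma pm_lift_single: "g k 0 = 0 \<Longrightarrow> pm_lift g (Poly_Mapping.single k v) = g k v"
  by (simp add: pm_lift_def)

lemma pm_lift_add:
  fixes p q :: "'a \<Rightarrow>\<^sub>0 'b::monoid_add"
  assumes "\<And>k. g k 0 = 0" and "\<And>k x y. g k (x + y) = g k x + g k y"
  shows "pm_lift g (p + q) = pm_lift g p + pm_lift g q"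
  unfolding pm_lift_def by (rule setsum_keys_plus_distrib) (rule assms)+

text \<open>Nested once per factor, this reduces bilinear identities between products of
  \<open>poly_mapping\<close> elements to monomials.\<close>

lemma poly_mapping_additive_induct [case_names zero single add]:
  fixes p :: "'a \<Rightarrow>\<^sub>0 'b::comm_monoid_add"
  assumes "P 0" and "\<And>k v. P (Poly_Mapping.single k v)" and "\<And>p q. P p \<Longrightarrow> P q \<Longrightarrow> P (p + q)"
  shows "P p"
proof -
  have "p = (\<Sum>k\<in>Poly_Mapping.keys p. Poly_Mapping.single k (Poly_Mapping.lookup p k))"
    by (rule poly_mapping_eqI)
      (simp add: lookup_sum lookup_single when_def in_keys_iff[symmetric] not_in_keys_iff_lookup_eq_zero)
  moreover have "P (\<Sum>k\<in>S. Poly_Mapping.single k (Poly_Mapping.lookup p k))" for S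
    by (induction S rule: infinite_finite_induct) (auto intro: assms)
  ultimately show ?thesis by metis
qed

abbreviation Kpoly :: "(('n::linorder param \<Rightarrow>\<^sub>0 nat) \<Rightarrow>\<^sub>0 rat) \<Rightarrow> 'n ratfun" where
  "Kpoly p \<equiv> Fract p 1"

lemma Kpoly_add: "Kpoly (p + q) = Kpoly p + Kpoly q"
  and Kpoly_mult: "Kpoly (p * q) = Kpoly p * Kpoly q"
  and Kpoly_eq_iff: "Kpoly p = Kpoly q \<longleftrightarrow> p = q"
  and Kpoly_0: "Kpoly 0 = 0"
  and Kpoly_1: "Kpoly 1 = 1"
  by (simp_all add: eq_fract fract_collapse)

lemma Kpoly_sum: "Kpoly (\<Sum>i\<in>S. f i) = (\<Sum>i\<in>S. Kpoly (f i))"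
  by (induction S rule: infinite_finite_induct) (simp_all add: Kpoly_0 Kpoly_add del: add_fract)

lemma of_int_Kpoly: "of_int n = Kpoly (Poly_Mapping.single 0 (of_int n))"
proof -
  have *: "of_nat k = Kpoly (Poly_Mapping.single 0 (of_nat k))" for k
    by (simp add: of_nat_fract)
  show ?thesis
    by (cases n rule: int_cases2) (simp_all add: * single_uminus del: single_of_nat)
qed

lemma of_rat_Kpoly: "of_rat r = (Kpoly (Poly_Mapping.single 0 r) :: 'a::linorder ratfun)"
proof (cases r)
  case (Fract a b)
  have "Kpoly (Poly_Mapping.single 0 r) * of_int b = (of_int a :: 'a ratfun)"
    using Fract unfolding of_int_Kpoly Kpoly_mult[symmetric] by (simp only: mult_single) (simp add: Fract_of_int_quotient)
  moreover have "of_rat r * of_int b = (of_int a :: 'a ratfun)"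
  proof -
    have "r * of_int b = of_int a" using Fract by (simp add: Fract_of_int_quotient)
    then have "of_rat (r * of_int b) = (of_rat (of_int a) :: 'a ratfun)" by simp
    then show ?thesis by (simp add: of_rat_mult)
  qed
  ultimately show ?thesis
    using Fract by (metis less_irrefl mult_cancel_right of_int_eq_0_iff)
qed

lemma Kvar_nonzero [simp]: "Kvar v \<noteq> 0"
  by (simp add: Kvar_def Kpoly_0[symmetric] Kpoly_eq_iff) (metis lookup_single_eq lookup_zero zero_neq_one)

lemma Kvar_power: "Kvar v ^ k = Kpoly (Poly_Mapping.single (Poly_Mapping.single v k) 1)"
  by (induction k) (simp_all add: Kvar_def Kpoly_1 mult_single single_add[symmetric])

section \<open>Laurent monomials in the parameters and their linear independence\<close>

definition pmon :: "('v::finite \<Rightarrow> nat) \<Rightarrow> 'v \<Rightarrow>\<^sub>0 nat" where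
  "pmon e = (\<Sum>v\<in>UNIV. Poly_Mapping.single v (e v))"

lemma lookup_pmon [simp]: "Poly_Mapping.lookup (pmon e) v = e v"
  by (simp add: pmon_def lookup_sum lookup_single when_def)

lemma pmon_lookup [simp]: "pmon (Poly_Mapping.lookup m) = m"
  by (rule poly_mapping_eqI) simp

lemma Gmon_of_nat:
  "Gmon (\<lambda>v. int (e v)) = Kpoly (Poly_Mapping.single (pmon e) 1)"
proof -
  have "(\<Prod>v\<in>S. Kvar v ^ e v) = Kpoly (Poly_Mapping.single (\<Sum>v\<in>S. Poly_Mapping.single v (e v)) 1)" for S
    by (induction S rule: infinite_finite_induct) (simp_all add: Kpoly_1 Kvar_power mult_single)
  then show ?thesis by (simp add: Gmon_def pmon_def)
qed

lemma Gmon_nonzero [simp]: "Gmon e \<noteq> 0"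
  by (simp add: Gmon_def)

lemma Gmon_add: "Gmon (\<lambda>v. e v + f v) = Gmon e * Gmon f"
  by (simp add: Gmon_def power_int_add prod.distrib)

lemma Gmon_0 [simp]: "Gmon (\<lambda>v. 0) = 1"
  by (simp add: Gmon_def)

lemma Gmon_minus: "Gmon (\<lambda>v. - e v) = inverse (Gmon e)"
  using Gmon_add[of e "\<lambda>v. - e v"] by (simp add: inverse_unique)

lemma Gmon_linear_independent:
  fixes S :: "('a::{finite,linorder} param \<Rightarrow> int) set"
  assumes "finite S" and "(\<Sum>e\<in>S. of_rat (c e) * Gmon e) = 0" and "e \<in> S"
  shows "c e = 0"
proof -
  \<comment> \<open>\<open>N\<close> bounds all exponents in absolute value. Multiplying by
    \<open>Gmon (\<lambda>_. N)\<close> therefore clears every negative exponent and leaves a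
    relation between distinct ordinary monomials.\<close>
  define N where "N = (\<Sum>e\<in>S. \<Sum>v\<in>UNIV. \<bar>e v\<bar>)"
  have N: "e v + N \<ge> 0" if "e \<in> S" for e :: "'a param \<Rightarrow> int" and v
  proof -
    have "\<bar>e v\<bar> \<le> (\<Sum>v\<in>UNIV. \<bar>e v\<bar>)" by (rule member_le_sum) auto
    also have "\<dots> \<le> N" unfolding N_def using that \<open>finite S\<close> by (intro member_le_sum) (auto intro: sum_nonneg)
    finally show ?thesis by linarith
  qed
  define s where "s = (\<lambda>e :: 'a param \<Rightarrow> int. pmon (\<lambda>v. nat (e v + N)))"
  have "0 = (\<Sum>e\<in>S. of_rat (c e) * Gmon e) * Gmon (\<lambda>_. N)"
    using assms(2) by simp
  also have "\<dots> = (\<Sum>e\<in>S. of_rat (c e) * Gmon (\<lambda>v. int (nat (e v + N))))"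
    by (simp add: sum_distrib_right mult.assoc Gmon_add[symmetric] N)
  also have "\<dots> = Kpoly (\<Sum>e\<in>S. Poly_Mapping.single (s e) (c e))"
    by (simp add: Gmon_of_nat of_rat_Kpoly mult_single Kpoly_sum s_def del: int_nat_eq)
  finally have "(\<Sum>e\<in>S. Poly_Mapping.single (s e) (c e)) = 0"
    by (simp add: Kpoly_0[symmetric] Kpoly_eq_iff)
  then have "(\<Sum>e'\<in>S. Poly_Mapping.lookup (Poly_Mapping.single (s e') (c e')) (s e)) = 0"
    by (simp add: lookup_sum[symmetric])
  moreover have "s e' = s e \<longleftrightarrow> e' = e" if "e' \<in> S" for e'
  proof
    assume "s e' = s e"
    then have "nat (e' v + N) = nat (e v + N)" for v
      unfolding s_def by (metis lookup_pmon)
    then show "e' = e" using N[OF that] N[OF \<open>e \<in> S\<close>] by (auto simp: fun_eq_iff eq_nat_nat_iff)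
  qed simp
  ultimately have "(\<Sum>e'\<in>S. if e' = e then c e' else 0) = 0"
    by (simp add: lookup_single when_def cong: sum.cong)
  with assms show ?thesis by simp
qed

lemma inj_Gmon: "inj Gmon"
proof (rule injI, rule ccontr)
  fix e f :: "'n::{finite,linorder} param \<Rightarrow> int"
  assume "Gmon e = Gmon f" "e \<noteq> f"
  then have "(\<Sum>x\<in>{e, f}. of_rat (if x = e then 1 else - 1) * Gmon x) = 0" by simp
  from Gmon_linear_independent[OF _ this, of e] show False by simp
qed

definition inv_eval :: "(('n::{finite,linorder} param \<Rightarrow>\<^sub>0 nat) \<Rightarrow>\<^sub>0 rat) \<Rightarrow> 'n ratfun" where
  "inv_eval = pm_lift (\<lambda>m r. of_rat r * Gmon (\<lambda>v. - int (Poly_Mapping.lookup m v)))"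

lemma inv_eval_add: "inv_eval (p + q) = inv_eval p + inv_eval q"
  unfolding inv_eval_def by (rule pm_lift_add) (simp_all add: of_rat_add distrib_right)

lemma inv_eval_single:
  "inv_eval (Poly_Mapping.single m r) = of_rat r * Gmon (\<lambda>v. - int (Poly_Mapping.lookup m v))"
  by (simp add: inv_eval_def pm_lift_single)

lemma inv_eval_0: "inv_eval 0 = 0" by (simp add: inv_eval_def)

lemma inv_eval_1: "inv_eval 1 = 1"
  using inv_eval_single[of 0 1] by simp

lemma inv_eval_mult: "inv_eval (p * q) = inv_eval p * inv_eval q"
proof (induction p rule: poly_mapping_additive_induct)
  case (single m r)
  show ?case
  proof (induction q rule: poly_mapping_additive_induct)
    case (single m' r')
    show ?case
      by (simp add: mult_single inv_eval_single of_rat_mult lookup_add Gmon_add[symmetric] mult_ac)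
  qed (simp_all add: inv_eval_0 inv_eval_add distrib_left)
qed (simp_all add: inv_eval_0 inv_eval_add distrib_right)

text \<open>Inverting the variables keeps distinct monomials distinct, so independence of Laurent
  monomials gives injectivity. This keeps denominators nonzero when \<open>inv_eval\<close> is
  extended to fractions.\<close>

lemma inv_eval_eq_0_iff: "inv_eval p = 0 \<longleftrightarrow> p = 0"
proof
  let ?e = "\<lambda>m v. - int (Poly_Mapping.lookup m v)"
  assume 0: "inv_eval p = 0"
  have inj: "inj_on ?e S" for S
    by (auto simp: inj_on_def fun_eq_iff intro: poly_mapping_eqI)
  have "(\<Sum>e\<in>?e ` Poly_Mapping.keys p. of_rat (Poly_Mapping.lookup p (pmon (\<lambda>v. nat (- e v)))) * Gmon e) = inv_eval p"
    by (simp add: sum.reindex[OF inj] inv_eval_def pm_lift_def)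
  then have "Poly_Mapping.lookup p (pmon (\<lambda>v. nat (- ?e m v))) = 0" if "m \<in> Poly_Mapping.keys p" for m
    using that 0 by (intro Gmon_linear_independent[of "?e ` Poly_Mapping.keys p"]) auto
  then show "p = 0"
    by (intro poly_mapping_eqI) (auto simp: in_keys_iff)
qed (simp add: inv_eval_0)

lift_definition Kbar :: "'n::{finite,linorder} ratfun \<Rightarrow> 'n ratfun"
  is "\<lambda>x. inv_eval (fst x) / inv_eval (snd x)"
  by (auto simp: frac_eq_eq inv_eval_eq_0_iff inv_eval_mult[symmetric])

lemma Kbar_Fract: "b \<noteq> 0 \<Longrightarrow> Kbar (Fract a b) = inv_eval a / inv_eval b"
  by transfer simp

lemma Kbar_Kpoly: "Kbar (Kpoly p) = inv_eval p"
  by (simp add: Kbar_Fract inv_eval_1)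

lemma Kbar_add: "Kbar (x + y) = Kbar x + Kbar y"
  by (cases x; cases y)
    (simp add: Kbar_Fract inv_eval_add inv_eval_mult inv_eval_eq_0_iff field_simps)

lemma Kbar_mult: "Kbar (x * y) = Kbar x * Kbar y"
  by (cases x; cases y) (simp add: Kbar_Fract inv_eval_mult)

lemma Kbar_of_rat [simp]: "Kbar (of_rat r) = of_rat r"
  by (subst of_rat_Kpoly) (simp add: Kbar_Kpoly inv_eval_single)

lemma Kbar_0 [simp]: "Kbar 0 = 0" and Kbar_1 [simp]: "Kbar 1 = 1"
  using Kbar_of_rat[of 0] Kbar_of_rat[of 1] by simp_all

lemma Kbar_Kvar: "Kbar (Kvar v) = inverse (Kvar v)"
proof -
  have "Kbar (Kvar v) = Gmon (\<lambda>u. - int (Poly_Mapping.lookup (Poly_Mapping.single v 1) u))"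
    unfolding Kvar_def by (simp add: Kbar_Kpoly inv_eval_single)
  also have "\<dots> = inverse (Kvar v)"
    unfolding Gmon_minus Gmon_of_nat by (simp add: Kvar_def)
  finally show ?thesis .
qed

text \<open>The target is an arbitrary ring because the lemma serves both for self-maps of the field
  and for scalars inside the noncommutative algebra.\<close>

lemma ratfun_hom_eqI:
  fixes f g :: "'n::{finite,linorder} ratfun \<Rightarrow> 'b::ring_1"
  assumes f: "\<And>x y. f (x + y) = f x + f y" "\<And>x y. f (x * y) = f x * f y" "f 1 = 1"
    and g: "\<And>x y. g (x + y) = g x + g y" "\<And>x y. g (x * y) = g x * g y" "g 1 = 1"
    and rat: "\<And>r. f (of_rat r) = g (of_rat r)" and var: "\<And>v. f (Kvar v) = g (Kvar v)"
  shows "f x = g x"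
proof -
  have pow: "f (Kvar v ^ k) = g (Kvar v ^ k)" for v k
    by (induction k) (simp_all add: f g var)
  have prod: "f (\<Prod>v\<in>S. Kvar v ^ e v) = g (\<Prod>v\<in>S. Kvar v ^ e v)" for S and e :: "_ \<Rightarrow> nat"
    by (induction S rule: infinite_finite_induct) (simp_all add: f g pow)
  have single: "f (Kpoly (Poly_Mapping.single m r)) = g (Kpoly (Poly_Mapping.single m r))" for m r
  proof -
    have "Kpoly (Poly_Mapping.single m r) = of_rat r * (\<Prod>v\<in>UNIV. Kvar v ^ Poly_Mapping.lookup m v)"
      using Gmon_of_nat[of "Poly_Mapping.lookup m"] by (simp add: of_rat_Kpoly mult_single Gmon_def)
    then show ?thesis by (simp add: f g rat prod)
  qed
  have poly: "f (Kpoly p) = g (Kpoly p)" for p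
  proof (induction p rule: poly_mapping_additive_induct)
    case zero
    show ?case using rat[of 0] by (simp add: Kpoly_0)
  qed (simp_all add: single Kpoly_add f g del: add_fract)
  \<comment> \<open>Inverses are unique even without commutativity: \<open>f (inverse y)\<close> is
    a left inverse and \<open>g (inverse y)\<close> a right inverse of the same element.\<close>
  have inv: "f (inverse y) = g (inverse y)" if "f y = g y" "y \<noteq> 0" for y
  proof -
    have "f (inverse y) = f (inverse y) * (g y * g (inverse y))"
      using that by (simp add: g(2)[symmetric] g(3))
    also have "\<dots> = f (inverse y * y) * g (inverse y)"
      using that(1) by (simp add: f(2) mult.assoc)
    finally show ?thesis using that by (simp add: f(3))
  qed
  show ?thesis
  proof (cases x)
    case (Fract a b)
    then have "x = Kpoly a * inverse (Kpoly b)" "Kpoly b \<noteq> 0"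
      by (simp_all add: Kpoly_0[symmetric] Kpoly_eq_iff)
    then show ?thesis by (simp only: f g poly inv[OF poly \<open>Kpoly b \<noteq> 0\<close>])
  qed
qed

lemma Kbar_Kbar [simp]: "Kbar (Kbar x) = x"
proof (rule ratfun_hom_eqI[of "\<lambda>x. Kbar (Kbar x)" "\<lambda>x. x"])
  have "Kbar (inverse (Kvar v)) = Kvar v" for v
  proof -
    have "Kbar (Kvar v * inverse (Kvar v)) = 1" by (simp add: field_simps)
    then show ?thesis unfolding Kbar_mult by (simp add: Kbar_Kvar field_simps)
  qed
  then show "Kbar (Kbar (Kvar v)) = Kvar v" for v by (simp add: Kbar_Kvar)
qed (simp_all add: Kbar_add Kbar_mult)

lemma Kbar_inverse: "Kbar (inverse x) = inverse (Kbar x)"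
proof (cases "x = 0")
  case False
  then have "Kbar x * Kbar (inverse x) = 1" by (simp add: Kbar_mult[symmetric])
  then show ?thesis by (simp add: inverse_unique)
qed simp

lemma Kbar_uminus: "Kbar (- x) = - Kbar x"
  using Kbar_add[of x "- x"] by (simp add: eq_neg_iff_add_eq_0 add.commute)

lemma Kbar_diff: "Kbar (x - y) = Kbar x - Kbar y"
  using Kbar_add[of x "- y"] by (simp add: Kbar_uminus)

lemma Kbar_sum: "Kbar (\<Sum>i\<in>S. f i) = (\<Sum>i\<in>S. Kbar (f i))"
  by (induction S rule: infinite_finite_induct) (simp_all add: Kbar_add)

lemma Kbar_prod: "Kbar (\<Prod>i\<in>S. f i) = (\<Prod>i\<in>S. Kbar (f i))"
  by (induction S rule: infinite_finite_induct) (simp_all add: Kbar_mult)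

lemma Kbar_of_int [simp]: "Kbar (of_int n) = of_int n"
  using Kbar_of_rat[of "of_int n"] by simp

lemma Kbar_power: "Kbar (x ^ k) = Kbar x ^ k"
  by (induction k) (simp_all add: Kbar_mult)

lemma Kbar_power_int: "Kbar (x powi n) = Kbar x powi n"
  by (simp add: power_int_def Kbar_power flip: Kbar_inverse)

lemma Kbar_Gmon: "Kbar (Gmon e) = Gmon (\<lambda>v. - e v)"
  unfolding Gmon_minus by (simp add: Gmon_def Kbar_prod Kbar_power_int Kbar_Kvar power_int_inverse prod_inversef[symmetric] comp_def)

section \<open>Laurent monomials and their integral span\<close>

lemma Gmon_in_Gamma: "Gmon e \<in> Gamma"
  by (auto simp: Gamma_def)

lemma Kvar_in_Gamma: "Kvar u \<in> Gamma"
proof -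
  have "Kvar u = Gmon (\<lambda>v. if v = u then 1 else 0)"
    by (simp add: Gmon_def if_distrib[of "\<lambda>n. _ powi n"] cong: if_cong)
  then show ?thesis by (simp add: Gmon_in_Gamma)
qed

lemma Gamma_1: "1 \<in> Gamma"
  using Gmon_in_Gamma[of "\<lambda>_. 0"] by simp

lemma Gamma_mult: "x \<in> Gamma \<Longrightarrow> y \<in> Gamma \<Longrightarrow> x * y \<in> Gamma"
  by (auto simp: Gamma_def Gmon_add[symmetric])

lemma Gamma_inverse: "x \<in> Gamma \<Longrightarrow> inverse x \<in> Gamma"
  by (auto simp: Gamma_def Gmon_minus[symmetric])

lemma Gamma_power: "x \<in> Gamma \<Longrightarrow> x ^ k \<in> Gamma"
  by (induction k) (auto intro: Gamma_1 Gamma_mult)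

lemma Gamma_power_int: "x \<in> Gamma \<Longrightarrow> x powi n \<in> Gamma"
  by (simp add: power_int_def Gamma_power Gamma_inverse)

lemma Gamma_nonzero: "x \<in> Gamma \<Longrightarrow> x \<noteq> 0"
  by (auto simp: Gamma_def)

lemma Kbar_Gamma: "x \<in> Gamma \<Longrightarrow> Kbar x = inverse x"
  by (auto simp: Gamma_def Kbar_Gmon Gmon_minus)

lemma kq_in_Gamma: "kq \<in> Gamma" and kp_in_Gamma: "kp i j \<in> Gamma" and kr_in_Gamma: "kr i j \<in> Gamma"
  by (simp_all add: kq_def kp_def kr_def Kvar_in_Gamma Gamma_inverse Gamma_1)

lemma kp_self [simp]: "kp i i = 1" and kr_self [simp]: "kr i i = 1"
  by (simp_all add: kp_def kr_def)

lemma kp_swap: "kp j i = inverse (kp i j)" and kr_swap: "kr j i = inverse (kr i j)"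
  by (auto simp: kp_def kr_def)

text \<open>Viewing the field as a module over the integers makes the library theory of spans
  available for the additive subgroups \<open>ZGamma\<close> and
  \<open>Z_Gamma_plus\<close>.\<close>

lemma module_int_mult: "module (\<lambda>(n::int) (x::'a::ring_1). of_int n * x)"
  by standard (simp_all add: algebra_simps)

definition ZGamma :: "'n::{finite,linorder} ratfun set" where
  "ZGamma = module.span (\<lambda>(n::int) x. of_int n * x) Gamma"

lemma Z_Gamma_plus_eq_span:
  "Z_Gamma_plus L = module.span (\<lambda>(n::int) x. of_int n * x) (Gamma_plus L)"
  unfolding Z_Gamma_plus_def module.span_explicit[OF module_int_mult] by auto

lemma Gamma_subset_ZGamma: "x \<in> Gamma \<Longrightarrow> x \<in> ZGamma"
  unfolding ZGamma_def by (rule module.span_base[OF module_int_mult])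

lemma ZGamma_0: "0 \<in> ZGamma"
  and ZGamma_add: "x \<in> ZGamma \<Longrightarrow> y \<in> ZGamma \<Longrightarrow> x + y \<in> ZGamma"
  and ZGamma_uminus: "x \<in> ZGamma \<Longrightarrow> - x \<in> ZGamma"
  unfolding ZGamma_def
  by (rule module.span_zero[OF module_int_mult] module.span_add[OF module_int_mult]
      module.span_neg[OF module_int_mult]; assumption)+

lemma ZGamma_1: "1 \<in> ZGamma"
  by (rule Gamma_subset_ZGamma[OF Gamma_1])

lemma ZGamma_diff: "x \<in> ZGamma \<Longrightarrow> y \<in> ZGamma \<Longrightarrow> x - y \<in> ZGamma"
  using ZGamma_add[of x "- y"] by (simp add: ZGamma_uminus)

lemma ZGamma_scale: "x \<in> ZGamma \<Longrightarrow> of_int n * x \<in> ZGamma"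
  unfolding ZGamma_def by (rule module.span_scale[OF module_int_mult])

lemma ZGamma_induct [consumes 1, case_names zero add]:
  assumes "x \<in> ZGamma" "P 0"
    and "\<And>n g y. g \<in> Gamma \<Longrightarrow> y \<in> ZGamma \<Longrightarrow> P y \<Longrightarrow> P (of_int n * g + y)"
  shows "P x"
proof -
  \<comment> \<open>Membership of the partial sums is carried along since the span induction does
    not supply it.\<close>
  have "x \<in> ZGamma \<and> P x"
  proof (rule module.span_induct_alt[OF module_int_mult, where S = Gamma and h = "\<lambda>x. x \<in> ZGamma \<and> P x"])
    show "x \<in> module.span (\<lambda>n x. of_int n * x) Gamma" using assms(1) by (simp add: ZGamma_def)
    show "0 \<in> ZGamma \<and> P 0" using assms(2) ZGamma_0 by simp
    show "of_int n * g + y \<in> ZGamma \<and> P (of_int n * g + y)" if "g \<in> Gamma" "y \<in> ZGamma \<and> P y" for n g y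
      using that assms(3) by (simp add: ZGamma_add ZGamma_scale Gamma_subset_ZGamma)
  qed
  then show ?thesis ..
qed

lemma ZGamma_mult: 
  assumes "x \<in> ZGamma" "y \<in> ZGamma"
  shows "x * y \<in> ZGamma"
  using assms(1)
proof (induction rule: ZGamma_induct)
  case (add n g x)
  have "g * y \<in> ZGamma"
    using assms(2)
  proof (induction rule: ZGamma_induct)
    case (add m h y)
    have "of_int m * (g * h) + g * y \<in> ZGamma"
      using add \<open>g \<in> Gamma\<close> by (simp add: ZGamma_add ZGamma_scale Gamma_subset_ZGamma Gamma_mult)
    then show ?case by (simp add: algebra_simps)
  qed (simp add: ZGamma_0)
  then have "of_int n * (g * y) + x * y \<in> ZGamma"
    using add by (intro ZGamma_add ZGamma_scale)
  then show ?case by (simp add: algebra_simps)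
qed (simp add: ZGamma_0)

lemma ZGamma_Kbar: "x \<in> ZGamma \<Longrightarrow> Kbar x \<in> ZGamma"
proof (induction rule: ZGamma_induct)
  case (add n g y)
  then show ?case
    by (simp add: Kbar_add Kbar_mult Kbar_Gamma ZGamma_add ZGamma_scale Gamma_subset_ZGamma Gamma_inverse)
qed (simp add: ZGamma_0)

lemma Z_Gamma_plus_0: "0 \<in> Z_Gamma_plus L"
  and Z_Gamma_plus_add: "x \<in> Z_Gamma_plus L \<Longrightarrow> y \<in> Z_Gamma_plus L \<Longrightarrow> x + y \<in> Z_Gamma_plus L"
  and Z_Gamma_plus_uminus: "x \<in> Z_Gamma_plus L \<Longrightarrow> - x \<in> Z_Gamma_plus L"
  unfolding Z_Gamma_plus_eq_span
  by (rule module.span_zero[OF module_int_mult] module.span_add[OF module_int_mult]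
      module.span_neg[OF module_int_mult]; assumption)+

lemma Z_Gamma_plus_diff: "x \<in> Z_Gamma_plus L \<Longrightarrow> y \<in> Z_Gamma_plus L \<Longrightarrow> x - y \<in> Z_Gamma_plus L"
  using Z_Gamma_plus_add[of x L "- y"] by (simp add: Z_Gamma_plus_uminus)

lemma Z_Gamma_plus_scale: "x \<in> Z_Gamma_plus L \<Longrightarrow> of_int n * x \<in> Z_Gamma_plus L"
  unfolding Z_Gamma_plus_eq_span by (rule module.span_scale[OF module_int_mult])

lemma Gamma_plus_subset_Z_Gamma_plus: "x \<in> Gamma_plus L \<Longrightarrow> x \<in> Z_Gamma_plus L"
  unfolding Z_Gamma_plus_eq_span by (rule module.span_base[OF module_int_mult])

lemma Z_Gamma_plus_subset_ZGamma: "x \<in> Z_Gamma_plus L \<Longrightarrow> x \<in> ZGamma"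
  unfolding Z_Gamma_plus_eq_span ZGamma_def
  using module.span_mono[OF module_int_mult, of "Gamma_plus L" Gamma] by (auto simp: Gamma_plus_def)

section \<open>The lexicographic order on exponent vectors and the splitting of
  \<open>ZGamma\<close> by sign\<close>

definition lex_pos :: "'v list \<Rightarrow> ('v \<Rightarrow> int) \<Rightarrow> bool" where
  "lex_pos L e \<longleftrightarrow> (\<exists>k<length L. e (L ! k) > 0 \<and> (\<forall>l<k. e (L ! l) = 0))"

lemma lex_pos_asym:
  assumes "lex_pos L e"
  shows "\<not> lex_pos L (\<lambda>v. - e v)"
proof
  assume "lex_pos L (\<lambda>v. - e v)"
  with assms obtain k k' where "e (L ! k) > 0" "\<forall>l<k. e (L ! l) = 0" "e (L ! k') < 0" "\<forall>l<k'. e (L ! l) = 0"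
    by (auto simp: lex_pos_def)
  then show False by (cases k k' rule: linorder_cases) auto
qed

lemma lex_pos_cases:
  assumes "set L = UNIV"
  obtains "e = (\<lambda>v. 0)" | "lex_pos L e" | "lex_pos L (\<lambda>v. - e v)"
proof (cases "\<exists>k<length L. e (L ! k) \<noteq> 0")
  case True
  define k where "k = (LEAST k. k < length L \<and> e (L ! k) \<noteq> 0)"
  have "k < length L \<and> e (L ! k) \<noteq> 0" unfolding k_def by (rule LeastI_ex) (use True in auto)
  moreover have "\<forall>l<k. e (L ! l) = 0"
    using not_less_Least[of _ "\<lambda>k. k < length L \<and> e (L ! k) \<noteq> 0"] calculation
    unfolding k_def[symmetric] by (meson less_trans)
  ultimately have "lex_pos L e \<or> lex_pos L (\<lambda>v. - e v)"
    by (cases "e (L ! k) > 0") (auto simp: lex_pos_def)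
  then show ?thesis using that by blast
next
  case False
  then have "e v = 0" for v
    using assms in_set_conv_nth[of v L] by auto
  then show ?thesis using that by blast
qed

text \<open>Generators are less than 1, so \<open>lex_pos\<close> of an exponent vector means an
  element below 1, and elements of \<open>Gamma_plus\<close> have \<open>lex_pos\<close> for the
  negated vector. Injectivity of \<open>Gmon\<close> removes the choice of vector in
  \<open>below_one\<close>.\<close>

lemma Gamma_plus_iff: "Gmon e \<in> Gamma_plus L \<longleftrightarrow> lex_pos L (\<lambda>v. - e v)"
proof -
  have "1 / Gmon e = Gmon f \<longleftrightarrow> f = (\<lambda>v. - e v)" for f
    by (auto simp: inverse_eq_divide[symmetric] Gmon_minus[symmetric] inj_eq[OF inj_Gmon])
  then show ?thesis
    by (auto simp: Gamma_plus_def Gamma_less_def below_one_def Gmon_in_Gamma Gamma_1 lex_pos_def)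
qed

lemma param_cases:
  obtains (Q) "v = paramQ" | (P) i j where "i < j" "v = paramP i j" | (R) i j where "i < j" "v = paramR i j"
  using Rep_param_inverse[of v, symmetric] Rep_param[of v]
  by (auto simp: paramQ_def paramP_def paramR_def)

lemma admissible_listing_UNIV:
  assumes "admissible_listing L"
  shows "set L = UNIV"
proof -
  have "v \<in> set L" for v
    using assms unfolding admissible_listing_def by (cases v rule: param_cases) auto
  then show ?thesis by blast
qed

text \<open>By totality each Laurent monomial lies in \<open>Gamma_plus\<close>, equals 1, or is the
  inverse, hence the \<open>Kbar\<close> image, of an element of \<open>Gamma_plus\<close>.\<close>

lemma ZGamma_split:
  assumes "set L = UNIV" "x \<in> ZGamma"
  shows "\<exists>y\<in>Z_Gamma_plus L. \<exists>z\<in>Z_Gamma_plus L. \<exists>n. x = y + of_int n + Kbar z"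
  using assms(2)
proof (induction rule: ZGamma_induct)
  case zero
  show ?case
    by (intro bexI[of _ 0] exI[of _ 0]) (simp_all add: Z_Gamma_plus_0)
next
  case (add m g x)
  then obtain y z n where IH: "y \<in> Z_Gamma_plus L" "z \<in> Z_Gamma_plus L" "x = y + of_int n + Kbar z" by blast
  from add obtain e where e: "g = Gmon e" by (auto simp: Gamma_def)
  show ?case
  proof (cases rule: lex_pos_cases[OF assms(1), of e])
    case 1
    then show ?thesis
      using IH e by (intro bexI[of _ y] bexI[of _ z] exI[of _ "m + n"]) simp_all
  next
    case 2
    then have "inverse g \<in> Gamma_plus L"
      unfolding e Gmon_minus[symmetric] Gamma_plus_iff by simp
    then have "of_int m * inverse g + z \<in> Z_Gamma_plus L"
      by (intro Z_Gamma_plus_add Z_Gamma_plus_scale Gamma_plus_subset_Z_Gamma_plus IH)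
    then show ?thesis
      using IH \<open>g \<in> Gamma\<close> by (intro bexI[of _ y] bexI[of _ "of_int m * inverse g + z"] exI[of _ n])
        (simp_all add: Kbar_add Kbar_mult Kbar_inverse Kbar_Gamma)
  next
    case 3
    then have "of_int m * g + y \<in> Z_Gamma_plus L"
      unfolding e Gamma_plus_iff[symmetric]
      by (intro Z_Gamma_plus_add Z_Gamma_plus_scale Gamma_plus_subset_Z_Gamma_plus IH)
    then show ?thesis
      using IH by (intro bexI[of _ "of_int m * g + y"] bexI[of _ z] exI[of _ n]) simp_all
  qed
qed

lemma Z_Gamma_plus_as_sum:
  fixes L :: "'n::{finite,linorder} param list"
  assumes "x \<in> Z_Gamma_plus L"
  shows "\<exists>S (c :: ('n param \<Rightarrow> int) \<Rightarrow> int). finite S \<and> (\<forall>e\<in>S. lex_pos L (\<lambda>v. - e v)) \<and> x = (\<Sum>e\<in>S. of_int (c e) * Gmon e)"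
proof -
  from assms obtain T c where T: "finite T" "T \<subseteq> Gamma_plus L" "x = (\<Sum>g\<in>T. of_int (c g) * g)"
    by (auto simp: Z_Gamma_plus_def)
  have "T = Gmon ` (Gmon -` T)" using T(2) by (auto simp: Gamma_plus_def Gamma_def)
  then have "x = (\<Sum>e\<in>Gmon -` T. of_int (c (Gmon e)) * Gmon e)"
    using T(3) sum.reindex[of Gmon "Gmon -` T" "\<lambda>g. of_int (c g) * g"] inj_Gmon
    by (metis (no_types, lifting) comp_apply inj_on_subset subset_UNIV sum.cong)
  moreover have "finite (Gmon -` T)" using T(1) inj_Gmon by (rule finite_vimageI)
  moreover have "\<forall>e\<in>Gmon -` T. lex_pos L (\<lambda>v. - e v)"
    using T(2) by (auto simp: Gamma_plus_iff[symmetric])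
  ultimately show ?thesis by (intro exI[of _ "Gmon -` T"] exI[of _ "\<lambda>e. c (Gmon e)"] conjI)
qed

text \<open>The three summands involve only Laurent monomials greater than, equal to and less than 1
  respectively, so a relation between them splits.\<close>

lemma Z_Gamma_plus_independent:
  fixes L :: "'a::{finite,linorder} param list"
  assumes "x \<in> Z_Gamma_plus L" "y \<in> Z_Gamma_plus L" "x + of_int n + Kbar y = 0"
  shows "x = 0 \<and> n = 0"
proof -
  obtain S c where S: "finite S" "\<And>e. e \<in> S \<Longrightarrow> lex_pos L (\<lambda>v. - e v)" "x = (\<Sum>e\<in>S. of_int (c e) * Gmon e)"
    using Z_Gamma_plus_as_sum[OF assms(1)] by auto
  obtain T d where T: "finite T" "\<And>e. e \<in> T \<Longrightarrow> lex_pos L (\<lambda>v. - e v)" "y = (\<Sum>e\<in>T. of_int (d e) * Gmon e)"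
    using Z_Gamma_plus_as_sum[OF assms(2)] by auto
  define neg :: "('a param \<Rightarrow> int) \<Rightarrow> 'a param \<Rightarrow> int" where "neg = (\<lambda>e v. - e v)"
  have neg: "inj_on neg A" "neg (neg e) = e" for A e by (auto simp: neg_def inj_on_def fun_eq_iff)
  have not0: "\<not> lex_pos L (\<lambda>v. 0)" by (simp add: lex_pos_def)
  have disj: "S \<inter> ({\<lambda>v. 0} \<union> neg ` T) = {}" "{\<lambda>v. 0} \<inter> neg ` T = {}"
    using S(2) T(2) lex_pos_asym not0 by (fastforce simp: neg_def)+
  \<comment> \<open>One coefficient function on the union of three disjoint sets of exponent
    vectors; negation turns the vectors in \<open>T\<close> into those occurring in
    \<open>Kbar y\<close>.\<close>
  define C where "C = (\<lambda>e. of_int (if e \<in> S then c e else if e = (\<lambda>v. 0) then n else d (neg e)) :: rat)"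
  let ?U = "S \<union> ({\<lambda>v. 0} \<union> neg ` T)"
  have "(\<Sum>e\<in>?U. of_rat (C e) * Gmon e)
      = (\<Sum>e\<in>S. of_rat (C e) * Gmon e) + ((\<Sum>e\<in>{\<lambda>v. 0}. of_rat (C e) * Gmon e) + (\<Sum>e\<in>neg ` T. of_rat (C e) * Gmon e))"
    using disj S(1) T(1) by (subst sum.union_disjoint; (subst sum.union_disjoint)?) auto
  also have "(\<Sum>e\<in>S. of_rat (C e) * Gmon e) = x"
    by (simp add: S(3) C_def)
  also have "(\<Sum>e\<in>{\<lambda>v. 0}. of_rat (C e) * Gmon e) = of_int n"
    using disj by (simp add: C_def)
  also have "(\<Sum>e\<in>neg ` T. of_rat (C e) * Gmon e) = (\<Sum>e\<in>T. of_int (d e) * Gmon (neg e))"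
  proof -
    have "neg e \<notin> S" "neg e \<noteq> (\<lambda>v. 0)" if "e \<in> T" for e
      using disj imageI[OF that, of neg] by auto
    then show ?thesis
      by (subst sum.reindex[OF neg(1)]) (simp add: C_def neg(2) cong: sum.cong)
  qed
  also have "\<dots> = Kbar y"
    by (simp add: T(3) Kbar_sum Kbar_mult Kbar_Gmon neg_def)
  finally have "(\<Sum>e\<in>?U. of_rat (C e) * Gmon e) = 0"
    using assms(3) by (simp add: add.assoc)
  then have C: "C e = 0" if "e \<in> ?U" for e
    using that S(1) T(1) by (intro Gmon_linear_independent[of ?U]) auto
  have "c e = 0" if "e \<in> S" for e using C[of e] that by (simp add: C_def)
  moreover have "n = 0" using C[of "\<lambda>v. 0"] disj by (simp add: C_def)
  ultimately show ?thesis by (simp add: S(3))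
qed

text \<open>\<open>x - Kbar x = 0\<close> is a relation in the direct decomposition. Uniqueness of
  the canonical elements comes from here.\<close>

lemma Kbar_invariant_Z_Gamma_plus:
  assumes "x \<in> Z_Gamma_plus L" "Kbar x = x"
  shows "x = 0"
  using Z_Gamma_plus_independent[of x L "- x" 0] assms by (simp add: Z_Gamma_plus_uminus Kbar_uminus)

text \<open>For \<open>x = y + of_int n + Kbar z\<close> the equation \<open>x + Kbar x = 0\<close>
  has the components \<open>y + z\<close>, \<open>2 * n\<close> and \<open>Kbar (y + z)\<close>;
  hence \<open>z = - y\<close> and \<open>n = 0\<close>.\<close>

lemma Kbar_antiinvariant_ZGamma:
  assumes "set L = UNIV" "x \<in> ZGamma" "Kbar x = - x"
  obtains y where "y \<in> Z_Gamma_plus L" "x = y - Kbar y"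
proof -
  obtain y z n where *: "y \<in> Z_Gamma_plus L" "z \<in> Z_Gamma_plus L" "x = y + of_int n + Kbar z"
    using ZGamma_split[OF assms(1,2)] by blast
  have "(y + z) + of_int (2 * n) + Kbar (y + z) = x + Kbar x"
    by (simp add: *(3) Kbar_add)
  also have "\<dots> = 0" using assms(3) by simp
  finally have "y + z = 0 \<and> 2 * n = 0"
    using * by (intro Z_Gamma_plus_independent[where L = L]) (simp_all add: Z_Gamma_plus_add)
  then have "x = y - Kbar y"
    using *(3) by (simp add: eq_neg_iff_add_eq_0[symmetric] Kbar_uminus)
  with * that show ?thesis by blast
qed

section \<open>Row operators\<close>

definition bump :: "'c \<Rightarrow> ('c \<Rightarrow> int) \<Rightarrow> 'c \<Rightarrow> int" where
  "bump j a = (\<lambda>m. if m = j then a m + 1 else a m)"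

definition unbump :: "'c \<Rightarrow> ('c \<Rightarrow> int) \<Rightarrow> 'c \<Rightarrow> int" where
  "unbump j a = (\<lambda>m. if m = j then a m - 1 else a m)"

lemma bump_commute: "bump j (bump t a) = bump t (bump j a)"
  and unbump_commute: "unbump j (unbump t a) = unbump t (unbump j a)"
  and bump_unbump: "unbump j (bump t a) = bump t (unbump j a)"
  by (auto simp: bump_def unbump_def fun_eq_iff)

definition tail_weight :: "'k::field \<Rightarrow> ('c::{finite,linorder} \<Rightarrow> int) \<Rightarrow> 'c \<Rightarrow> 'k" where
  "tail_weight l a k = l powi (\<Sum>m | k < m. a m)"

text \<open>In \<open>Z_st x\<^sup>a = \<Sum>\<^sub>k c\<^sub>k x\<^sup>b Z_sk\<close>, with \<open>x\<^sup>a\<close> a monomial in an earlier row and \<open>b\<close> obtained from \<open>a\<close> by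
  replacing a column index \<open>k\<close> by \<open>t\<close>, the coefficient is \<open>c\<^sub>k = row_coeff q\<^sup>2 t k a\<close> (untwisted algebra).
  Exponents are integers so that no subtraction is truncated.\<close>

definition row_coeff :: "'k::field \<Rightarrow> 'c::{finite,linorder} \<Rightarrow> 'c \<Rightarrow> ('c \<Rightarrow> int) \<Rightarrow> 'k" where
  "row_coeff l t k a =
     (if k < t then (l powi a k - 1) * tail_weight l a k
      else if k = t then l powi a k * tail_weight l a k else 0)"

text \<open>\<open>Zop l s t\<close> is the transpose of left multiplication by \<open>Z_st\<close> with \<open>l = q\<^sup>2\<close>, in coordinates
  with respect to the ordered monomials; so products act in reverse order.\<close>

fun Zop :: "'k::field \<Rightarrow> nat \<Rightarrow> 'c::{finite,linorder} \<Rightarrow> ((nat \<Rightarrow> 'c \<Rightarrow> int) \<Rightarrow> 'k) \<Rightarrow> (nat \<Rightarrow> 'c \<Rightarrow> int) \<Rightarrow> 'k" where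
  "Zop l 0 j f A = f (case_nat (bump j (A 0)) (\<lambda>i. A (Suc i)))"
| "Zop l (Suc s) t f A = (\<Sum>k\<in>UNIV. row_coeff l t k (A 0) *
     Zop l s k (\<lambda>A'. f (case_nat (bump t (unbump k (A 0))) A')) (\<lambda>i. A (Suc i)))"

lemma Zop_add: "Zop l s t (\<lambda>A. f A + g A) = (\<lambda>A. Zop l s t f A + Zop l s t g A)"
proof (induction s arbitrary: t f g)
  case (Suc s)
  show ?case
    by (rule ext) (simp add: Suc sum.distrib distrib_left)
qed (simp add: fun_eq_iff)

lemma Zop_scale: "Zop l s t (\<lambda>A. c * f A) = (\<lambda>A. c * Zop l s t f A)"
proof (induction s arbitrary: t f)
  case (Suc s)
  show ?case
    by (rule ext) (simp add: Suc sum_distrib_left mult_ac)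
qed (simp add: fun_eq_iff)

lemma Zop_zero: "Zop l s t (\<lambda>A. 0) = (\<lambda>A. 0)"
  using Zop_scale[of l s t 0 "\<lambda>_. 0"] by simp

lemma Zop_sum: "Zop l s t (\<lambda>A. \<Sum>k\<in>S. f k A) = (\<lambda>A. \<Sum>k\<in>S. Zop l s t (f k) A)"
  by (induction S rule: infinite_finite_induct) (simp_all add: Zop_zero Zop_add)

lemma tail_weight_bump:
  assumes "l \<noteq> 0"
  shows "tail_weight l (bump j a) k = (if k < j then l else 1) * tail_weight l a k"
    and "tail_weight l (unbump j a) k = (if k < j then inverse l else 1) * tail_weight l a k"
proof -
  have "bump j a = (\<lambda>m. a m + (if m = j then 1 else 0))"
    and "unbump j a = (\<lambda>m. a m - (if m = j then 1 else 0))"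
    by (auto simp: bump_def unbump_def)
  with assms show "tail_weight l (bump j a) k = (if k < j then l else 1) * tail_weight l a k"
    "tail_weight l (unbump j a) k = (if k < j then inverse l else 1) * tail_weight l a k"
    by (simp_all add: tail_weight_def sum.distrib sum_subtractf power_int_add power_int_diff field_simps)
qed

lemma powi_bump:
  assumes "l \<noteq> (0 :: 'k::field)"
  shows "l powi bump j a k = (if k = j then l else 1) * l powi a k"
    and "l powi unbump j a k = (if k = j then inverse l else 1) * l powi a k"
  using assms by (auto simp: bump_def unbump_def power_int_add power_int_diff field_simps)

text \<open>The relations between a letter of row 0 in column \<open>j\<close> and a letter of a
  later row in column \<open>t\<close>, read off on coefficients. This is the case of
  \<open>Zop_exchange\<close> in which the earlier row is row 0.\<close>

lemma row_coeff_bump: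
  assumes "l \<noteq> 0"
  shows "row_coeff l t k (bump j a) =
    (if j < t then row_coeff l t k a + (l - 1) * row_coeff l j k a else l * row_coeff l t k a)"
  using assms
  by (auto simp: row_coeff_def tail_weight_bump powi_bump algebra_simps)

text \<open>Two letters of later rows pass row 0: the first enters with column \<open>j\<close> and
  leaves with \<open>k\<close>; the second then meets the altered row, entering with column
  \<open>t\<close> and leaving with \<open>m\<close>.\<close>

definition pair_coeff :: "'k::field \<Rightarrow> ('c::{finite,linorder} \<Rightarrow> int) \<Rightarrow> 'c \<Rightarrow> 'c \<Rightarrow> 'c \<Rightarrow> 'c \<Rightarrow> 'k" where
  "pair_coeff l a j k t m = row_coeff l j k a * row_coeff l t m (bump j (unbump k a))"

text \<open>These intertwine the exchange rule for the entering columns \<open>j\<close>,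
  \<open>t\<close> with the one for the leaving columns \<open>k\<close>, \<open>m\<close>, which
  drives the induction on rows. For each relative position of the columns this is an identity
  between powers of \<open>l\<close>.\<close>

lemma pair_coeff_exchange:
  assumes "l \<noteq> 0"
  shows "j \<le> t \<Longrightarrow> k < m \<Longrightarrow>
      pair_coeff l a j k t m = pair_coeff l a t m j k + (l - 1) * pair_coeff l a j m t k"
    and "j \<le> t \<Longrightarrow> k < m \<Longrightarrow> l * pair_coeff l a j m t k = pair_coeff l a t k j m"
    and "pair_coeff l a j k t k = pair_coeff l a t k j k"
  using assms
  by (auto simp: pair_coeff_def row_coeff_def tail_weight_bump powi_bump field_simps)

lemma pair_coeff_symmetric:
  assumes "l \<noteq> 0" "k < m"
  shows "pair_coeff l a t k j m + pair_coeff l a t m j k = pair_coeff l a j k t m + pair_coeff l a j m t k"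
proof (cases "j \<le> t")
  case True
  then show ?thesis
    using pair_coeff_exchange(1,2)[OF assms(1) True assms(2), of a] by (simp add: algebra_simps)
next
  case False
  then have "t \<le> j" by simp
  from pair_coeff_exchange(1,2)[OF assms(1) this assms(2), of a] show ?thesis
    by (simp add: algebra_simps)
qed

text \<open>The double sums below do not agree term by term: exchanging the leaving columns mixes
  \<open>(k, m)\<close> with \<open>(m, k)\<close>, so terms are compared in pairs.\<close>

lemma sum_sum_eqI:
  fixes F F' :: "'c::{finite,linorder} \<Rightarrow> 'c \<Rightarrow> 'k::comm_monoid_add"
  assumes "\<And>k m. k < m \<Longrightarrow> F k m + F m k = F' k m + F' m k"
    and "\<And>k. F k k = F' k k"
  shows "(\<Sum>k\<in>UNIV. \<Sum>m\<in>UNIV. F k m) = (\<Sum>k\<in>UNIV. \<Sum>m\<in>UNIV. F' k m)"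
proof -
  have split: "(\<Sum>k\<in>UNIV. \<Sum>m\<in>UNIV. G k m) =
      (\<Sum>(k, m) | k < m. G k m + G m k) + (\<Sum>k\<in>UNIV. G k k)"
    for G :: "'c \<Rightarrow> 'c \<Rightarrow> 'k"
  proof -
    have eq: "UNIV = {(k, m). k < m} \<union> {(k, m). m < k} \<union> range (\<lambda>k::'c. (k, k))"
      by (auto simp: image_iff)
    have "(\<Sum>k\<in>UNIV. \<Sum>m\<in>UNIV. G k m) = (\<Sum>(k, m)\<in>UNIV. G k m)"
      by (simp add: sum.cartesian_product)
    also have "\<dots> = (\<Sum>(k, m)\<in>{(k, m). k < m} \<union> {(k, m). m < k}. G k m) + (\<Sum>(k, m)\<in>range (\<lambda>k. (k, k)). G k m)"
      by (subst eq, rule sum.union_disjoint) auto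
    also have "(\<Sum>(k, m)\<in>{(k, m). k < m} \<union> {(k, m). m < k}. G k m)
        = (\<Sum>(k, m)\<in>{(k, m). k < m}. G k m) + (\<Sum>(k, m)\<in>{(k, m). m < k}. G k m)"
      by (rule sum.union_disjoint) auto
    also have "(\<Sum>(k, m)\<in>{(k, m). m < k}. G k m) = (\<Sum>(k, m)\<in>{(k, m). k < m}. G m k)"
      by (rule sum.reindex_bij_witness[of _ prod.swap prod.swap]) auto
    also have "(\<Sum>(k, m)\<in>range (\<lambda>k. (k, k)). G k m) = (\<Sum>k\<in>UNIV. G k k)"
      by (subst sum.reindex) (auto simp: inj_on_def)
    finally show ?thesis by (simp add: sum.distrib case_prod_unfold)
  qed
  show ?thesis
    unfolding split using assms by (intro arg_cong2[of _ _ _ _ "(+)"] sum.cong) auto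
qed

text \<open>By transposition the outer operator belongs to the letter next to the monomial, which
  passes row 0 first.\<close>

lemma Zop_Suc_Suc:
  "Zop l (Suc s) t (Zop l (Suc i) j f) A =
    (\<Sum>m\<in>UNIV. \<Sum>k\<in>UNIV. pair_coeff l (A 0) t m j k *
      Zop l s m (Zop l i k (\<lambda>A'. f (case_nat (bump j (bump t (unbump k (unbump m (A 0))))) A'))) (\<lambda>i. A (Suc i)))"
  by (simp add: pair_coeff_def Zop_sum Zop_scale sum_distrib_left mult.assoc bump_unbump)

text \<open>Without the twist, letters of one row commute. By induction the part behind row 0 is
  symmetric in the leaving columns, so only symmetrized coefficients have to agree.\<close>

lemma Zop_row_commute: "l \<noteq> 0 \<Longrightarrow> Zop l s t (Zop l s j f) = Zop l s j (Zop l s t f)"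
proof (induction s arbitrary: t j f)
  case 0
  show ?case by (simp add: fun_eq_iff bump_commute)
next
  case (Suc s)
  note l = \<open>l \<noteq> 0\<close>
  show ?case
  proof
    fix A :: "nat \<Rightarrow> 'b \<Rightarrow> int"
    define C where "C = pair_coeff l (A 0)"
    define G where "G = (\<lambda>k m A'. f (case_nat (bump j (bump t (unbump k (unbump m (A 0))))) A'))"
    define Y where "Y = (\<lambda>m k. Zop l s m (Zop l s k (G k m)) (\<lambda>i. A (Suc i)))"
    have "G k m = G m k" for k m by (simp add: G_def unbump_commute)
    then have Y: "Y m k = Y k m" for k m by (simp add: Y_def Suc.IH[OF l, of m k])
    have 1: "Zop l (Suc s) t (Zop l (Suc s) j f) A = (\<Sum>m\<in>UNIV. \<Sum>k\<in>UNIV. C t m j k * Y m k)"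
      unfolding Zop_Suc_Suc C_def G_def Y_def ..
    have 2: "Zop l (Suc s) j (Zop l (Suc s) t f) A = (\<Sum>m\<in>UNIV. \<Sum>k\<in>UNIV. C j m t k * Y m k)"
      unfolding Zop_Suc_Suc C_def G_def Y_def by (simp only: bump_commute[of t j])
    show "Zop l (Suc s) t (Zop l (Suc s) j f) A = Zop l (Suc s) j (Zop l (Suc s) t f) A"
      unfolding 1 2
    proof (rule sum_sum_eqI)
      fix k m :: 'b
      assume "k < m"
      then show "C t k j m * Y k m + C t m j k * Y m k = C j k t m * Y k m + C j m t k * Y m k"
        using pair_coeff_symmetric[OF l, of k m "A 0" t j] unfolding Y[of m k] C_def
        by (simp only: distrib_right[symmetric])
    next
      show "C t k j k * Y k k = C j k t k * Y k k" for k
        using pair_coeff_exchange(3)[OF l, of "A 0" t k j] by (simp add: C_def)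
    qed
  qed
qed

text \<open>The relations for \<open>Z_st Z_ij\<close> in transposed form, \<open>l\<close> standing
  for \<open>q\<^sup>2\<close>. Unless the earlier row is row 0, both letters pass row 0 and the
  induction hypothesis exchanges what leaves it.\<close>

lemma Zop_exchange:
  "l \<noteq> 0 \<Longrightarrow> i < s \<Longrightarrow> Zop l i j (Zop l s t f) A =
    (if j < t then Zop l s t (Zop l i j f) A + (l - 1) * Zop l s j (Zop l i t f) A
     else l * Zop l s t (Zop l i j f) A)"
proof (induction s arbitrary: i t j f A)
  case (Suc s)
  note l = \<open>l \<noteq> 0\<close>
  show ?case
  proof (cases i)
    case 0
    show ?thesis
      by (auto simp: 0 fun_eq_iff row_coeff_bump l bump_unbump sum_distrib_left sum.distrib[symmetric]
          algebra_simps bump_commute[of t j] intro!: sum.cong)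
  next
    case (Suc i')
    with Suc.prems have "i' < s" by simp
    note IH = Suc.IH[OF l this]
    define C where "C = pair_coeff l (A 0)"
    note ex = pair_coeff_exchange[OF l, where a = "A 0", folded C_def]
    define G where "G = (\<lambda>k m A'. f (case_nat (bump j (bump t (unbump k (unbump m (A 0))))) A'))"
    have G: "G k m = G m k" for k m by (simp add: G_def unbump_commute)
    define Y where "Y = (\<lambda>k m. Zop l s m (Zop l i' k (G k m)) (\<lambda>i. A (Suc i)))"
    \<comment> \<open>\<open>X\<close> is what the induction hypothesis yields for the leaving
      columns; the diagonal \<open>k = m\<close> falls under the second branch, with factor
      \<open>l\<close>.\<close>
    define X where "X = (\<lambda>k m. if k < m then Y k m + (l - 1) * Y m k else l * Y k m)"
    have X: "Zop l i' k (Zop l s m (G m k)) (\<lambda>i. A (Suc i)) = X k m" for k m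
      by (simp add: X_def Y_def IH G[of m k])
    have 1: "Zop l i j (Zop l (Suc s) t f) A = (\<Sum>k\<in>UNIV. \<Sum>m\<in>UNIV. C j k t m * X k m)"
      unfolding Suc Zop_Suc_Suc C_def X[symmetric] G_def bump_commute[of t j] ..
    have 2: "Zop l (Suc s) t (Zop l i j f) A = (\<Sum>k\<in>UNIV. \<Sum>m\<in>UNIV. C t m j k * Y k m)"
      unfolding Suc Zop_Suc_Suc C_def Y_def G_def by (rule sum.swap)
    have 3: "Zop l (Suc s) j (Zop l i t f) A = (\<Sum>k\<in>UNIV. \<Sum>m\<in>UNIV. C j m t k * Y k m)"
      unfolding Suc Zop_Suc_Suc C_def Y_def G_def bump_commute[of t j] by (rule sum.swap)
    show ?thesis
    proof (cases "j < t")
      case True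
      have "(\<Sum>k\<in>UNIV. \<Sum>m\<in>UNIV. C j k t m * X k m) =
        (\<Sum>k\<in>UNIV. \<Sum>m\<in>UNIV. (C t m j k + (l - 1) * C j m t k) * Y k m)"
      proof (rule sum_sum_eqI)
        fix k m :: 'b
        assume "k < m"
        show "C j k t m * X k m + C j m t k * X m k =
         (C t m j k + (l - 1) * C j m t k) * Y k m + (C t k j m + (l - 1) * C j k t m) * Y m k"
          using order.asym[OF \<open>k < m\<close>] unfolding ex(1)[OF less_imp_le[OF True] \<open>k < m\<close>] ex(2)[OF less_imp_le[OF True] \<open>k < m\<close>, symmetric]
          by (auto simp: X_def algebra_simps)
      next
        fix k
        show "C j k t k * X k k = (C t k j k + (l - 1) * C j k t k) * Y k k"
          using ex(3)[of j k t] by (auto simp: X_def algebra_simps)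
      qed
      then show ?thesis
        using True unfolding 1 2 3
        by (simp add: distrib_right sum.distrib sum_distrib_left mult.assoc)
    next
      case False
      have "(\<Sum>k\<in>UNIV. \<Sum>m\<in>UNIV. C j k t m * X k m) =
        (\<Sum>k\<in>UNIV. \<Sum>m\<in>UNIV. (l * C t m j k) * Y k m)"
      proof (rule sum_sum_eqI)
        fix k m :: 'b
        assume "k < m"
        show "C j k t m * X k m + C j m t k * X m k = l * C t m j k * Y k m + l * C t k j m * Y m k"
          using order.asym[OF \<open>k < m\<close>] unfolding ex(1)[OF leI[OF False] \<open>k < m\<close>] ex(2)[OF leI[OF False] \<open>k < m\<close>, symmetric]
          by (auto simp: X_def algebra_simps)
      next
        fix k
        show "C j k t k * X k k = (l * C t k j k) * Y k k"
          using ex(3)[of j k t] by (auto simp: X_def algebra_simps)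
      qed
      then show ?thesis
        using False unfolding 1 2
        by (simp add: sum_distrib_left mult.assoc)
    qed
  qed
qed simp

section \<open>Linear functionals on the quantum matrix algebra\<close>

definition row_index :: "'n::{finite,linorder} \<Rightarrow> nat" where
  "row_index s = card {i. i < s}"

lemma row_index_less_iff [simp]: "row_index i < row_index s \<longleftrightarrow> i < s"
proof -
  have *: "row_index i < row_index s" if "i < s" for i s :: 'a
    unfolding row_index_def using that by (intro psubset_card_mono) auto
  show ?thesis using *[of i s] *[of s i] by (cases i s rule: linorder_cases) auto
qed

lemma row_index_eq_iff [simp]: "row_index i = row_index s \<longleftrightarrow> i = s"
  by (metis row_index_less_iff less_irrefl linorder_cases)

text \<open>This is \<open>f\<close>, extended linearly, at the product of the word with the
  monomial of the matrix in the untwisted algebra. The last letter is next to the monomial and hence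
  outermost.\<close>

fun word_op :: "'k::field \<Rightarrow> ('n::{finite,linorder} \<times> 'n) list \<Rightarrow> ((nat \<Rightarrow> 'n \<Rightarrow> int) \<Rightarrow> 'k) \<Rightarrow> (nat \<Rightarrow> 'n \<Rightarrow> int) \<Rightarrow> 'k" where
  "word_op l [] f = f"
| "word_op l ((s, t) # w) f = word_op l w (Zop l (row_index s) t f)"

lemma word_op_append: "word_op l (u @ v) f = word_op l v (word_op l u f)"
  by (induction u arbitrary: f) auto

lemma word_op_add: "word_op l w (\<lambda>A. f A + g A) = (\<lambda>A. word_op l w f A + word_op l w g A)"
  by (induction w arbitrary: f g) (auto simp: Zop_add)

lemma word_op_scale: "word_op l w (\<lambda>A. c * f A) = (\<lambda>A. c * word_op l w f A)"
  by (induction w arbitrary: f) (auto simp: Zop_scale)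

fun word_content :: "('n::{finite,linorder} \<times> 'n) list \<Rightarrow> nat \<Rightarrow> 'n \<Rightarrow> int" where
  "word_content [] = (\<lambda>r c. 0)"
| "word_content ((s, t) # w) = (\<lambda>r. if r = row_index s then bump t (word_content w r) else word_content w r)"

lemma word_content_eq: "word_content w (row_index s) t = int (count_list w (s, t))"
  by (induction w rule: word_content.induct) (auto simp: bump_def)

text \<open>All rows before \<open>s\<close> are empty: passing such a row, only
  \<open>k = t\<close> contributes, with coefficient 1.\<close>

lemma Zop_eval:
  assumes "\<And>r. r < s \<Longrightarrow> A r = (\<lambda>c. 0)"
  shows "Zop l s t f A = f (\<lambda>r. if r = s then bump t (A r) else A r)"
  using assms
proof (induction s arbitrary: t f A)
  case 0
  have "case_nat (bump t (A 0)) (\<lambda>i. A (Suc i)) = (\<lambda>r. if r = 0 then bump t (A r) else A r)"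
    by (auto simp: fun_eq_iff split: nat.splits)
  then show ?case by simp
next
  case (Suc s)
  have A0: "A 0 = (\<lambda>c. 0)" using Suc.prems by simp
  then have coeff: "row_coeff l t k (A 0) = (if k = t then 1 else 0)" for k
    by (simp add: row_coeff_def tail_weight_def)
  have "Zop l (Suc s) t f A = Zop l s t (\<lambda>A'. f (case_nat (bump t (unbump t (A 0))) A')) (\<lambda>i. A (Suc i))"
    by (simp add: coeff if_distrib[of "\<lambda>x. x * _"] cong: if_cong)
  also have "\<dots> = f (case_nat (bump t (unbump t (A 0))) (\<lambda>r. if r = s then bump t (A (Suc r)) else A (Suc r)))"
    using Suc.prems by (subst Suc.IH) auto
  also have "case_nat (bump t (unbump t (A 0))) (\<lambda>r. if r = s then bump t (A (Suc r)) else A (Suc r))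
      = (\<lambda>r. if r = Suc s then bump t (A r) else A r)"
    by (auto simp: fun_eq_iff bump_def unbump_def split: nat.splits)
  finally show ?case .
qed

text \<open>Letters act from the last to the first, so each one meets only letters of its own or
  later rows and is simply added.\<close>

lemma word_op_eval:
  assumes "sorted (map fst w)"
  shows "word_op l w f (\<lambda>r c. 0) = f (word_content w)"
  using assms
proof (induction w arbitrary: f)
  case (Cons a w)
  obtain s t where a: "a = (s, t)" by force
  have zero: "word_content w' r = (\<lambda>c. 0)" if "\<forall>x\<in>set w'. s \<le> fst x" "r < row_index s" for r w'
    using that
  proof (induction w')
    case (Cons b w')
    then have "s \<le> fst b" by simp
    then have "row_index s \<le> row_index (fst b)" by (metis not_le row_index_less_iff)
    with Cons.prems have "r < row_index (fst b)" by simp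
    then show ?case using Cons by (cases b) auto
  qed auto
  have "word_op l (a # w) f (\<lambda>r c. 0) = Zop l (row_index s) t f (word_content w)"
    using Cons by (simp add: a)
  also have "\<dots> = f (word_content (a # w))"
    using Cons.prems by (subst Zop_eval) (auto simp: a zero)
  finally show ?case .
qed simp

lemma kq_nonzero [simp]: "kq \<noteq> (0 :: 'n::{finite,linorder} ratfun)"
  by (rule Gamma_nonzero[OF kq_in_Gamma])

lemma kp_nonzero [simp]: "kp i j \<noteq> (0 :: 'n::{finite,linorder} ratfun)"
  by (rule Gamma_nonzero[OF kp_in_Gamma])

lemma kr_nonzero [simp]: "kr i j \<noteq> (0 :: 'n::{finite,linorder} ratfun)"
  by (rule Gamma_nonzero[OF kr_in_Gamma])

text \<open>The bicharacter carrying the algebra with all \<open>p_ij = q_ij = 1\<close> to the general one.\<close>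

fun twist :: "'n::linorder \<times> 'n \<Rightarrow> 'n \<times> 'n \<Rightarrow> 'n ratfun" where
  "twist (s, t) (i, j) = (if i < s then (kp s i)\<^sup>2 else 1) * (if j < t then (kr t j)\<^sup>2 else 1)"

fun word_twist :: "('n::linorder \<times> 'n) list \<Rightarrow> 'n ratfun" where
  "word_twist [] = 1"
| "word_twist (a # w) = prod_list (map (twist a) w) * word_twist w"

lemma word_twist_append:
  "word_twist (u @ v) = word_twist u * word_twist v * prod_list (map (\<lambda>a. prod_list (map (twist a) v)) u)"
  by (induction u) (simp_all add: mult_ac)

lemma word_twist_nonzero: "word_twist w \<noteq> (0 :: 'a::{finite,linorder} ratfun)"
proof -
  have "twist a b \<noteq> 0" for a b :: "'a \<times> 'a"
    by (cases a; cases b) simp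
  then show ?thesis by (induction w) (auto simp: prod_list_zero_iff)
qed

lemma prod_list_map_mult:
  "prod_list (map (\<lambda>x. f x * g x) xs) = prod_list (map f xs) * (prod_list (map g xs) :: 'a::comm_monoid_mult)"
  by (induction xs) (simp_all add: mult_ac)

lemma twist_swap:
  "twist (i, t) c * twist (s, j) c = twist (s, t) c * twist (i, j) c"
  "twist c (i, t) * twist c (s, j) = twist c (s, t) * twist c (i, j)"
  by (cases c, simp only: twist.simps mult_ac)+

text \<open>The twist of the letters \<open>a, b\<close> against the rest of the word only depends on the rows and
  columns involved, so it is the same for all terms of a defining relation.\<close>

lemma word_twist_pair:
  obtains M where "word_twist (u @ [(s, t), (i, j)] @ v) = twist (s, t) (i, j) * M"
    and "word_twist (u @ [(i, j), (s, t)] @ v) = twist (i, j) (s, t) * M"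
    and "word_twist (u @ [(i, t), (s, j)] @ v) = twist (i, t) (s, j) * M"
proof -
  define M where "M = (\<lambda>a b. word_twist u * word_twist v
     * prod_list (map (\<lambda>c. twist c a * twist c b) u) * prod_list (map (\<lambda>c. twist a c * twist b c) v)
     * prod_list (map (\<lambda>c. prod_list (map (twist c) v)) u))"
  have *: "word_twist (u @ [a, b] @ v) = twist a b * M a b" for a b
    by (simp add: M_def word_twist_append prod_list_map_mult mult_ac)
  have "M (i, j) (s, t) = M (s, t) (i, j)" "M (i, t) (s, j) = M (s, t) (i, j)"
    by (simp_all only: M_def twist_swap(1)[of i t _ s j] twist_swap(2)[of _ i t s j]
        mult.commute[of "twist (i, j) _"] mult.commute[of "twist _ (i, j)"])
  with that[of "M (s, t) (i, j)"] show thesis by (simp only: *)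
qed

lemma word_op_exchange:
  assumes "l \<noteq> 0"
  shows "i < s \<Longrightarrow> j < t \<Longrightarrow> word_op l (u @ [(s, t), (i, j)] @ v) f A =
      word_op l (u @ [(i, j), (s, t)] @ v) f A + (l - 1) * word_op l (u @ [(i, t), (s, j)] @ v) f A"
    and "i < s \<Longrightarrow> t \<le> j \<Longrightarrow> word_op l (u @ [(s, t), (i, j)] @ v) f A =
      l * word_op l (u @ [(i, j), (s, t)] @ v) f A"
    and "word_op l (u @ [(i, t), (i, j)] @ v) f A = word_op l (u @ [(i, j), (i, t)] @ v) f A"
proof -
  let ?F = "word_op l u f"
  show "word_op l (u @ [(s, t), (i, j)] @ v) f A =
      word_op l (u @ [(i, j), (s, t)] @ v) f A + (l - 1) * word_op l (u @ [(i, t), (s, j)] @ v) f A"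
    if "i < s" "j < t"
  proof -
    have "Zop l (row_index i) j (Zop l (row_index s) t ?F) =
       (\<lambda>A. Zop l (row_index s) t (Zop l (row_index i) j ?F) A
         + (l - 1) * Zop l (row_index s) j (Zop l (row_index i) t ?F) A)"
      using Zop_exchange[OF assms, of "row_index i" "row_index s" j t ?F] that by (intro ext) simp
    then show ?thesis unfolding word_op_append word_op.simps by (simp only: word_op_add word_op_scale)
  qed
  show "word_op l (u @ [(s, t), (i, j)] @ v) f A = l * word_op l (u @ [(i, j), (s, t)] @ v) f A"
    if "i < s" "t \<le> j"
  proof -
    have "Zop l (row_index i) j (Zop l (row_index s) t ?F) =
       (\<lambda>A. l * Zop l (row_index s) t (Zop l (row_index i) j ?F) A)"
      using Zop_exchange[OF assms, of "row_index i" "row_index s" j t ?F] that by (intro ext) (simp add: not_less[symmetric])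
    then show ?thesis unfolding word_op_append word_op.simps by (simp only: word_op_scale)
  qed
  show "word_op l (u @ [(i, t), (i, j)] @ v) f A = word_op l (u @ [(i, j), (i, t)] @ v) f A"
    by (simp only: word_op_append word_op.simps Zop_row_commute[OF assms, of "row_index i" j t])
qed

text \<open>The zero matrix stands for the monomial 1, so \<open>f\<close> is evaluated at the word
  itself; the twist reinstates the parameters \<open>kp\<close> and \<open>kr\<close>.\<close>

definition pbw_word :: "((nat \<Rightarrow> 'n \<Rightarrow> int) \<Rightarrow> 'n ratfun) \<Rightarrow> ('n::{finite,linorder} \<times> 'n) list \<Rightarrow> 'n ratfun" where
  "pbw_word f w = word_twist w * word_op (kq\<^sup>2) w f (\<lambda>r c. 0)"

lemma pbw_word_rel1:
  assumes "i < s" "j < t"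
  shows "pbw_word f (u @ [(s, t), (i, j)] @ v) =
    (kp s i)\<^sup>2 * (kr t j)\<^sup>2 * pbw_word f (u @ [(i, j), (s, t)] @ v)
    + (kq\<^sup>2 - 1) * (kp s i)\<^sup>2 * pbw_word f (u @ [(i, t), (s, j)] @ v)"
proof -
  \<comment> \<open>The correction word shares the factor \<open>(kr t j)\<^sup>2\<close> with the
    word on the left, which is why only \<open>(kp s i)\<^sup>2\<close> accompanies
    \<open>kq\<^sup>2 - 1\<close>.\<close>
  have tw: "twist (s, t) (i, j) = (kp s i)\<^sup>2 * (kr t j)\<^sup>2" "twist (i, j) (s, t) = 1" "twist (i, t) (s, j) = (kr t j)\<^sup>2"
    using assms by auto
  obtain M where W: "word_twist (u @ [(s, t), (i, j)] @ v) = twist (s, t) (i, j) * M"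
    and W2: "word_twist (u @ [(i, j), (s, t)] @ v) = twist (i, j) (s, t) * M"
    and W3: "word_twist (u @ [(i, t), (s, j)] @ v) = twist (i, t) (s, j) * M"
    by (rule word_twist_pair)
  have op: "word_op (kq\<^sup>2) (u @ [(s, t), (i, j)] @ v) f (\<lambda>r c. 0) =
      word_op (kq\<^sup>2) (u @ [(i, j), (s, t)] @ v) f (\<lambda>r c. 0)
      + (kq\<^sup>2 - 1) * word_op (kq\<^sup>2) (u @ [(i, t), (s, j)] @ v) f (\<lambda>r c. 0)"
    using assms by (intro word_op_exchange) simp_all
  show ?thesis
    unfolding pbw_word_def W W2 W3 tw op by (simp add: algebra_simps)
qed

lemma pbw_word_rel2:
  assumes "i < s" "t \<le> j"
  shows "pbw_word f (u @ [(s, t), (i, j)] @ v) =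
    kq\<^sup>2 * (kp s i)\<^sup>2 * inverse ((kr j t)\<^sup>2) * pbw_word f (u @ [(i, j), (s, t)] @ v)"
proof -
  have tw: "twist (s, t) (i, j) = (kp s i)\<^sup>2" "twist (i, j) (s, t) = (kr j t)\<^sup>2"
    using assms by (auto simp: order_le_less)
  obtain M where W: "word_twist (u @ [(s, t), (i, j)] @ v) = twist (s, t) (i, j) * M"
    and W2: "word_twist (u @ [(i, j), (s, t)] @ v) = twist (i, j) (s, t) * M"
    by (rule word_twist_pair)
  have op: "word_op (kq\<^sup>2) (u @ [(s, t), (i, j)] @ v) f (\<lambda>r c. 0) =
      kq\<^sup>2 * word_op (kq\<^sup>2) (u @ [(i, j), (s, t)] @ v) f (\<lambda>r c. 0)"
    using assms by (intro word_op_exchange) simp_all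
  show ?thesis
    unfolding pbw_word_def W W2 tw op by (simp add: field_simps)
qed

lemma pbw_word_rel3:
  "pbw_word f (u @ [(i, t), (i, j)] @ v) = (kr t j)\<^sup>2 * pbw_word f (u @ [(i, j), (i, t)] @ v)"
proof -
  have tw: "twist (i, t) (i, j) = (kr t j)\<^sup>2 * twist (i, j) (i, t)"
    by (cases t j rule: linorder_cases) (auto simp: kr_swap[of j t] field_simps)
  obtain M where W: "word_twist (u @ [(i, t), (i, j)] @ v) = twist (i, t) (i, j) * M"
    and W2: "word_twist (u @ [(i, j), (i, t)] @ v) = twist (i, j) (i, t) * M"
    by (rule word_twist_pair)
  have op: "word_op (kq\<^sup>2) (u @ [(i, t), (i, j)] @ v) f (\<lambda>r c. 0) =
      word_op (kq\<^sup>2) (u @ [(i, j), (i, t)] @ v) f (\<lambda>r c. 0)"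
    by (intro word_op_exchange) simp
  show ?thesis
    unfolding pbw_word_def W W2 op by (simp only: tw mult_ac)
qed

section \<open>Functionals on the free algebra that vanish on the ideal of relations\<close>

fun ncword :: "'a ncmon \<Rightarrow> 'a list" where
  "ncword (NCMon w) = w"

lemma ncword_add: "ncword (a + b) = ncword a @ ncword b"
  by (cases a; cases b) simp

definition pbw_functional :: "((nat \<Rightarrow> 'n \<Rightarrow> int) \<Rightarrow> 'n ratfun) \<Rightarrow> 'n::{finite,linorder} free_alg \<Rightarrow> 'n ratfun" where
  "pbw_functional f = pm_lift (\<lambda>w c. c * pbw_word f (ncword w))"

lemma pbw_functional_add: "pbw_functional f (x + y) = pbw_functional f x + pbw_functional f y"
  unfolding pbw_functional_def by (rule pm_lift_add) (simp_all add: distrib_right)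

lemma pbw_functional_single:
  "pbw_functional f (Poly_Mapping.single w c) = c * pbw_word f (ncword w)"
  by (simp add: pbw_functional_def pm_lift_single)

lemma pbw_functional_0: "pbw_functional f 0 = 0"
  by (simp add: pbw_functional_def)

lemma pbw_functional_diff: "pbw_functional f (x - y) = pbw_functional f x - pbw_functional f y"
  using pbw_functional_add[of f "x - y" y] by simp

lemma pbw_functional_relator:
  assumes "r \<in> relators"
  shows "pbw_functional f (a * r * b) = 0"
proof (induction a rule: poly_mapping_additive_induct)
  case (single u c)
  show ?case
  proof (induction b rule: poly_mapping_additive_induct)
    case (single v d)
    have fz: "Poly_Mapping.single u c * (fconst x * fZ i j * fZ s t) * Poly_Mapping.single v d
      = Poly_Mapping.single (NCMon (ncword u @ [(i, j), (s, t)] @ ncword v)) (c * x * d)" for x i j s t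
      by (cases u; cases v) (simp add: fconst_def fZ_def mult_single zero_ncmon_def)
    have fz1: "Poly_Mapping.single u c * (fZ i j * fZ s t) * Poly_Mapping.single v d
      = Poly_Mapping.single (NCMon (ncword u @ [(i, j), (s, t)] @ ncword v)) (c * d)" for i j s t
      by (cases u; cases v) (simp add: fZ_def mult_single)
    from assms show ?case
      unfolding relators_def
    proof (elim UnE CollectE exE conjE)
      fix s t i j
      assume "i < s" "j < t" and r: "r = fZ s t * fZ i j
        - (fconst ((kp s i)\<^sup>2 * (kr t j)\<^sup>2) * fZ i j * fZ s t
           + fconst ((kq\<^sup>2 - 1) * (kp s i)\<^sup>2) * fZ i t * fZ s j)"
      then show ?case
        unfolding r right_diff_distrib left_diff_distrib distrib_left distrib_right fz fz1
          pbw_functional_diff pbw_functional_add pbw_functional_single ncword.simps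
          pbw_word_rel1[OF \<open>i < s\<close> \<open>j < t\<close>]
        by (simp add: mult_ac)
    next
      fix s t i j
      assume "i < s" "t \<le> j" and r: "r = fZ s t * fZ i j
        - fconst (kq\<^sup>2 * (kp s i)\<^sup>2 * inverse ((kr j t)\<^sup>2)) * fZ i j * fZ s t"
      then show ?case
        unfolding r right_diff_distrib left_diff_distrib distrib_left distrib_right fz fz1
          pbw_functional_diff pbw_functional_add pbw_functional_single ncword.simps
          pbw_word_rel2[OF \<open>i < s\<close> \<open>t \<le> j\<close>]
        by (simp add: mult_ac)
    next
      fix i j t
      assume r: "r = fZ i t * fZ i j - fconst ((kr t j)\<^sup>2) * fZ i j * fZ i t"
      show ?case
        unfolding r right_diff_distrib left_diff_distrib distrib_left distrib_right fz fz1
          pbw_functional_diff pbw_functional_add pbw_functional_single ncword.simps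
          pbw_word_rel3[of f _ i t j]
        by (simp add: mult_ac)
    qed
  qed (simp_all add: pbw_functional_0 pbw_functional_add distrib_left)
qed (simp_all add: pbw_functional_0 pbw_functional_add distrib_right)

lemma pbw_functional_ideal: "x \<in> two_sided_ideal relators \<Longrightarrow> pbw_functional f x = 0"
  by (induction rule: two_sided_ideal.induct)
    (simp_all add: pbw_functional_0 pbw_functional_add pbw_functional_relator)

lift_definition qmat_functional :: "((nat \<Rightarrow> 'n \<Rightarrow> int) \<Rightarrow> 'n ratfun) \<Rightarrow> 'n::{finite,linorder} qmat \<Rightarrow> 'n ratfun"
  is pbw_functional
proof -
  fix f and x y :: "'n free_alg"
  assume "cong_rel x y"
  then have "pbw_functional f (x - y) = 0"
    unfolding cong_rel_def by (rule pbw_functional_ideal)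
  then show "pbw_functional f x = pbw_functional f y" by (simp add: pbw_functional_diff)
qed

lemma qmat_functional_add: "qmat_functional f (x + y) = qmat_functional f x + qmat_functional f y"
  by transfer (rule pbw_functional_add)

lemma qmat_functional_scale: "qmat_functional f (Kscale c x) = c * qmat_functional f x"
  unfolding Kscale_def
proof transfer
  fix f c and x :: "'a free_alg"
  show "pbw_functional f (fconst c * x) = c * pbw_functional f x"
    by (induction x rule: poly_mapping_additive_induct)
      (simp_all add: pbw_functional_0 pbw_functional_add distrib_left pbw_functional_single fconst_def mult_single)
qed

definition Zword :: "('n::linorder \<times> 'n) list \<Rightarrow> 'n qmat" where
  "Zword w = prod_list (map (\<lambda>(i, j). Zgen i j) w)"

lemma Zword_eq_abs_qmat: "Zword w = abs_qmat (Poly_Mapping.single (NCMon w) 1)"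
proof (induction w)
  case Nil
  show ?case by (simp add: Zword_def one_qmat.abs_eq flip: zero_ncmon_def)
next
  case (Cons a w)
  then show ?case
    by (cases a) (simp add: Zword_def Zgen.abs_eq times_qmat.abs_eq fZ_def mult_single)
qed

lemma qmat_functional_Zword: "qmat_functional f (Zword w) = pbw_word f w"
  by (simp add: Zword_eq_abs_qmat qmat_functional.abs_eq pbw_functional_single)

section \<open>Normalized words\<close>

definition content :: "('n \<times> 'n) list \<Rightarrow> 'n nmat" where
  "content w = (\<lambda>i j. count_list w (i, j))"

definition sorted_word :: "'n::{finite,linorder} nmat \<Rightarrow> ('n \<times> 'n) list" where
  "sorted_word A = concat (map (\<lambda>x. replicate (A (fst x) (snd x)) x)
     (List.product (sorted_list_of_set UNIV) (sorted_list_of_set UNIV)))"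

lemma sorted_wrt_product:
  fixes xs :: "'a::order list" and ys :: "'b::order list"
  assumes "sorted_wrt (<) xs" "sorted_wrt (<) ys"
  shows "sorted_wrt (<) (List.product xs ys)"
  using assms(1)
proof (induction xs)
  case (Cons x xs)
  have "sorted_wrt (<) (map (Pair x) ys)"
    using assms(2) by (induction ys) (auto simp: less_prod_def less_le)
  then show ?case using Cons by (auto simp: sorted_wrt_append)
qed simp

lemma sorted_wrt_index_pairs:
  "sorted_wrt (<) (List.product (sorted_list_of_set (UNIV :: 'n::{finite,linorder} set)) (sorted_list_of_set (UNIV :: 'n set)))"
  by (intro sorted_wrt_product strict_sorted_list_of_set)

lemma sorted_concat_replicate:
  fixes xs :: "'a::linorder list"
  shows "sorted_wrt (<) xs \<Longrightarrow> sorted (concat (map (\<lambda>x. replicate (f x) x) xs))"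
  by (induction xs) (auto simp: sorted_append sorted_replicate intro: less_imp_le)

lemma count_list_replicate: "count_list (replicate n x) y = (if x = y then n else 0)"
  by (induction n) auto

lemma count_list_concat_replicate:
  "distinct xs \<Longrightarrow> count_list (concat (map (\<lambda>x. replicate (f x) x) xs)) y = (if y \<in> set xs then f y else 0)"
  by (induction xs) (auto simp: count_list_replicate)

lemma sorted_sorted_word: "sorted (sorted_word A)"
  unfolding sorted_word_def by (rule sorted_concat_replicate[OF sorted_wrt_index_pairs])

lemma content_sorted_word [simp]: "content (sorted_word A) = A"
  using sorted_wrt_index_pairs[where 'n = 'a]
  by (simp add: content_def sorted_word_def count_list_concat_replicate strict_sorted_iff)

lemma sorted_eq_sorted_word:
  assumes "sorted w"
  shows "sorted_word (content w) = w"
proof -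
  have "count_list (sorted_word (content w)) x = count_list w x" for x
    using fun_cong[OF fun_cong[OF content_sorted_word[of "content w"]], of "fst x" "snd x"]
    by (simp add: content_def)
  then have "mset (sorted_word (content w)) = mset w"
    by (intro multiset_eqI) (simp add: count_mset)
  then show ?thesis
    using assms sorted_sorted_word properties_for_sort by metis
qed

lemma Zmon_eq_Zword: "Zmon A = Zword (sorted_word A)"
proof -
  have "prod_list (map (\<lambda>(i, j). Zgen i j ^ A i j) xs) = Zword (concat (map (\<lambda>x. replicate (A (fst x) (snd x)) x) xs))"
    for xs :: "('a \<times> 'a) list"
  proof (induction xs)
    case (Cons x xs)
    have "prod_list (map (\<lambda>(i, j). Zgen i j) (replicate n x)) = (case x of (i, j) \<Rightarrow> Zgen i j) ^ n" for n
      by (induction n) auto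
    with Cons show ?case by (simp add: Zword_def case_prod_unfold)
  qed (simp add: Zword_def)
  then show ?thesis by (simp add: Zmon_def sorted_word_def Let_def)
qed

fun sym_factor :: "'n::linorder \<times> 'n \<Rightarrow> 'n \<times> 'n \<Rightarrow> 'n ratfun" where
  "sym_factor (i, j) (s, t) = kp s i * kr t j *
     kq powi (if i < s \<and> t \<le> j then 1 else if s < i \<and> j \<le> t then - 1 else 0)"

text \<open>The factor is antisymmetric under exchanging two letters, which makes the normalization below
  compatible with reversing words, and its square is the coefficient of the leading term in the
  relation for \<open>Z_st Z_ij\<close>.\<close>

lemma sym_factor_swap: "sym_factor a b = inverse (sym_factor b a)"
proof -
  obtain i j s t where "a = (i, j)" "b = (s, t)" by (cases a; cases b)
  then show ?thesis
    by (auto simp: kp_swap[of s i] kr_swap[of t j] power_int_minus)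
qed

lemma sym_factor_in_Gamma: "sym_factor a b \<in> Gamma"
  by (cases a; cases b)
    (simp only: sym_factor.simps Gamma_mult Gamma_power_int kp_in_Gamma kr_in_Gamma kq_in_Gamma)

lemma sym_factor_self: "sym_factor a a = 1"
  by (cases a) simp

fun word_factor :: "('n::linorder \<times> 'n) list \<Rightarrow> 'n ratfun" where
  "word_factor [] = 1"
| "word_factor (a # w) = prod_list (map (sym_factor a) w) * word_factor w"

lemma word_factor_append:
  "word_factor (u @ v) = word_factor u * word_factor v * prod_list (map (\<lambda>a. prod_list (map (sym_factor a) v)) u)"
  by (induction u) (simp_all add: mult_ac)

lemma prod_list_Gamma: "(\<And>x. x \<in> set xs \<Longrightarrow> f x \<in> Gamma) \<Longrightarrow> prod_list (map f xs) \<in> Gamma"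
  by (induction xs) (simp_all add: Gamma_1 Gamma_mult)

lemma word_factor_in_Gamma: "word_factor w \<in> Gamma"
  by (induction w) (simp_all add: Gamma_1 Gamma_mult prod_list_Gamma sym_factor_in_Gamma)

text \<open>Reversal changes the order of every pair of letters, and each pair contributes an
  antisymmetric factor.\<close>

lemma word_factor_rev: "word_factor (rev w) = inverse (word_factor w)"
proof (induction w)
  case (Cons a w)
  have "prod_list (map (\<lambda>x. sym_factor x a) w) = inverse (prod_list (map (sym_factor a) w))"
    by (induction w) (simp_all add: sym_factor_swap[of _ a])
  then show ?case
    by (simp add: word_factor_append Cons rev_map[symmetric] prod_list.rev)
qed simp

text \<open>Exchanging neighbours affects the order of a single pair; \<open>M\<close> collects the
  factors of all other pairs.\<close>

lemma word_factor_pair: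
  obtains M where "M \<in> Gamma" "word_factor (u @ [a, b] @ v) = sym_factor a b * M"
    "word_factor (u @ [b, a] @ v) = sym_factor b a * M"
proof -
  define M where "M = (\<lambda>a b. word_factor u * word_factor v
     * prod_list (map (\<lambda>c. sym_factor c a * sym_factor c b) u)
     * prod_list (map (\<lambda>c. sym_factor a c * sym_factor b c) v)
     * prod_list (map (\<lambda>c. prod_list (map (sym_factor c) v)) u))"
  have *: "word_factor (u @ [a, b] @ v) = sym_factor a b * M a b" for a b
    by (simp add: M_def word_factor_append prod_list_map_mult mult_ac)
  have "M b a = M a b"
    by (simp only: M_def mult.commute[of "sym_factor b _"] mult.commute[of "sym_factor _ b"])
  moreover have "M a b \<in> Gamma"
    unfolding M_def by (intro Gamma_mult word_factor_in_Gamma prod_list_Gamma sym_factor_in_Gamma)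
  ultimately show thesis using that[of "M a b"] by (simp only: *)
qed

lemma word_factor_replicate_append:
  "word_factor (replicate n x @ w) = prod_list (map (sym_factor x) w) ^ n * word_factor w"
proof (induction n)
  case (Suc n)
  have "prod_list (map (sym_factor x) (replicate n x)) = 1"
    by (induction n) (simp_all add: sym_factor_self)
  then show ?case by (simp add: Suc)
qed simp

text \<open>Equal letters contribute 1, and each pair of distinct letters occurs
  \<open>f a * f b\<close> times.\<close>

lemma word_factor_concat_replicate:
  fixes xs :: "('n::{finite,linorder} \<times> 'n) list"
  assumes "sorted_wrt (<) xs"
  shows "word_factor (concat (map (\<lambda>x. replicate (f x) x) xs)) =
    (\<Prod>a\<in>set xs. \<Prod>b\<in>set xs. if a < b then sym_factor a b ^ (f a * f b) else 1)"
  using assms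
proof (induction xs)
  case (Cons x xs)
  let ?g = "\<lambda>a b. if a < b then sym_factor a b ^ (f a * f b) else 1"
  from Cons.prems have x: "x \<notin> set xs" "\<And>y. y \<in> set xs \<Longrightarrow> x < y" "\<And>y. y \<in> set xs \<Longrightarrow> \<not> y < x"
    and xs: "sorted_wrt (<) xs" by auto
  have "prod_list (map (sym_factor x) (concat (map (\<lambda>x. replicate (f x) x) ys))) = (\<Prod>b\<in>set ys. sym_factor x b ^ f b)"
    if "distinct ys" for ys
    using that
  proof (induction ys)
    case (Cons y ys)
    have "prod_list (replicate n z) = z ^ n" for n and z :: "'n ratfun" by (induction n) auto
    with Cons show ?case by (simp add: map_replicate_const)
  qed simp
  moreover have "distinct xs" using xs strict_sorted_iff by blast
  ultimately have "word_factor (concat (map (\<lambda>x. replicate (f x) x) (x # xs))) =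
      (\<Prod>b\<in>set xs. sym_factor x b ^ f b) ^ f x * (\<Prod>a\<in>set xs. \<Prod>b\<in>set xs. ?g a b)"
    using Cons.IH[OF xs] by (simp add: word_factor_replicate_append)
  also have "(\<Prod>b\<in>set xs. sym_factor x b ^ f b) ^ f x = (\<Prod>b\<in>set xs. ?g x b)"
    by (simp add: prod_power_distrib power_mult[symmetric] x mult.commute cong: prod.cong)
  also have "(\<Prod>b\<in>set xs. ?g x b) = (\<Prod>b\<in>set (x # xs). ?g x b)"
    using x(1) by simp
  also have "(\<Prod>a\<in>set xs. \<Prod>b\<in>set xs. ?g a b) = (\<Prod>a\<in>set xs. \<Prod>b\<in>set (x # xs). ?g a b)"
    by (rule prod.cong[OF refl]) (simp add: x)
  finally show ?case using x(1) by simp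
qed simp

lemma prod_filter_UNIV:
  fixes f :: "'a::finite \<Rightarrow> 'b::comm_monoid_mult"
  shows "prod f {x. P x} = (\<Prod>x\<in>UNIV. if P x then f x else 1)"
  by (rule prod.mono_neutral_cong_left) auto

text \<open>The prescribed normalization is thus the antisymmetric one. Both sides are products over
  pairs of positions, and for each pair the four products in \<open>Dfactor\<close> together
  contribute one power of \<open>sym_factor\<close>.\<close>

lemma Dfactor_eq_word_factor: "Dfactor A = word_factor (sorted_word A)"
proof -
  have e: "kq ^ (\<Sum>x\<in>S. f x) = (\<Prod>x\<in>S. kq ^ f x)" for S :: "'b set" and f
    by (rule power_sum)
  have "Dfactor A = (\<Prod>(s, t, i, j)\<in>UNIV.
     (if i < s \<and> t \<le> j then kq ^ (A s t * A i j) else 1) * (if i < s then kp s i ^ (A s t * A i j) else 1)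
     * (if j < t \<and> i \<le> s then kr t j ^ (A s t * A i j) else 1)
     * (if i < s \<and> t < j then kr j t powi (- int (A s t * A i j)) else 1))"
    unfolding Dfactor_def e case_prod_unfold
    by (simp only: prod_filter_UNIV prod.distrib)
  also have "\<dots> = (\<Prod>(s, t, i, j)\<in>UNIV. if (i, j) < (s, t) then sym_factor (i, j) (s, t) ^ (A s t * A i j) else 1)"
  proof (intro prod.cong refl, clarify)
    fix s t i j :: 'a
    consider "i < s" "t < j" | "i < s" "t = j" | "i < s" "j < t" | "i = s" "j < t" | "\<not> (i, j) < (s, t)"
      by (auto simp: less_prod_def) (metis less_le neqE)
    then show "(if i < s \<and> t \<le> j then kq ^ (A s t * A i j) else 1) * (if i < s then kp s i ^ (A s t * A i j) else 1)
       * (if j < t \<and> i \<le> s then kr t j ^ (A s t * A i j) else 1)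
       * (if i < s \<and> t < j then kr j t powi (- int (A s t * A i j)) else 1) =
       (if (i, j) < (s, t) then sym_factor (i, j) (s, t) ^ (A s t * A i j) else 1)"
      by cases (auto simp: power_mult_distrib power_int_minus kr_swap[of t j] power_inverse simp del: of_nat_mult)
  qed
  also have "\<dots> = (\<Prod>a\<in>UNIV. \<Prod>b\<in>UNIV. if a < b then sym_factor a b ^ (A (fst a) (snd a) * A (fst b) (snd b)) else 1)"
    unfolding prod.cartesian_product
    by (rule prod.reindex_bij_witness[of _ "\<lambda>((i, j), (s, t)). (s, t, i, j)" "\<lambda>(s, t, i, j). ((i, j), (s, t))"])
      (auto simp: mult.commute simp del: sym_factor.simps)
  also have "\<dots> = word_factor (sorted_word A)"
    unfolding sorted_word_def word_factor_concat_replicate[OF sorted_wrt_index_pairs] by simp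
  finally show ?thesis .
qed

definition Nword :: "('n::linorder \<times> 'n) list \<Rightarrow> 'n qmat" where
  "Nword w = Kscale (word_factor w) (Zword w)"

lemma Znorm_eq_Nword: "Znorm A = Nword (sorted_word A)"
  by (simp add: Znorm_def Nword_def Dfactor_eq_word_factor Zmon_eq_Zword)

section \<open>Exchanging letters\<close>

lemma Kconst_add: "Kconst (a + b) = Kconst a + Kconst b"
  by transfer (simp add: fconst_def single_add equivp_reflp[OF equivp_cong_rel])

lemma Kconst_mult: "Kconst (a * b) = Kconst a * Kconst b"
  by transfer (simp add: fconst_def mult_single equivp_reflp[OF equivp_cong_rel])

lemma Kconst_1 [simp]: "Kconst 1 = 1"
  by transfer (simp add: fconst_def equivp_reflp[OF equivp_cong_rel])

lemma Kconst_commute: "x * Kconst c = Kconst c * x"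
proof transfer
  fix x :: "'a free_alg" and c
  have "x * fconst c = fconst c * x"
    by (induction x rule: poly_mapping_additive_induct)
      (simp_all add: fconst_def mult_single distrib_left distrib_right mult.commute)
  then show "cong_rel (x * fconst c) (fconst c * x)"
    by (simp add: equivp_reflp[OF equivp_cong_rel])
qed

interpretation Kscale: vector_space Kscale
  by (rule vector_space_Kscale)

lemma Kscale_mult_left: "Kscale c x * y = Kscale c (x * y)"
  by (simp add: Kscale_def mult.assoc)

lemma Kscale_mult_right: "x * Kscale c y = Kscale c (x * y)"
  by (simp add: Kscale_def mult.assoc[symmetric] Kconst_commute)

lemma relator_eq_0: "r \<in> relators \<Longrightarrow> abs_qmat r = 0"
  using two_sided_ideal.gen[of r relators 1 1] by (simp add: zero_qmat.abs_eq qmat.abs_eq_iff cong_rel_def)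

lemma abs_qmat_simps:
  "abs_qmat (x - y) = abs_qmat x - abs_qmat y"
  "abs_qmat (x + y) = abs_qmat x + abs_qmat y"
  "abs_qmat (x * y) = abs_qmat x * abs_qmat y"
  "abs_qmat (fconst c) = Kconst c"
  "abs_qmat (fZ i j) = Zgen i j"
proof -
  show plus: "abs_qmat (x + y) = abs_qmat x + abs_qmat y" for x y :: "'a free_alg"
    by (simp add: plus_qmat.abs_eq)
  show "abs_qmat (x - y) = abs_qmat x - abs_qmat y"
    using plus[of "x - y" y] by simp
qed (simp_all add: times_qmat.abs_eq Kconst.abs_eq Zgen.abs_eq)

lemma Zgen_rel1:
  assumes "i < s" "j < t"
  shows "Zgen s t * Zgen i j = Kscale ((kp s i)\<^sup>2 * (kr t j)\<^sup>2) (Zgen i j * Zgen s t)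
    + Kscale ((kq\<^sup>2 - 1) * (kp s i)\<^sup>2) (Zgen i t * Zgen s j)"
proof -
  have "fZ s t * fZ i j - (fconst ((kp s i)\<^sup>2 * (kr t j)\<^sup>2) * fZ i j * fZ s t
           + fconst ((kq\<^sup>2 - 1) * (kp s i)\<^sup>2) * fZ i t * fZ s j) \<in> relators"
    unfolding relators_def
    by (rule UnI1, rule UnI1, rule CollectI, rule exI[of _ s], rule exI[of _ t], rule exI[of _ i],
        rule exI[of _ j], intro conjI refl assms)
  from relator_eq_0[OF this] show ?thesis
    by (simp add: abs_qmat_simps Kscale_def mult.assoc)
qed

lemma Zgen_rel2:
  assumes "i < s" "t \<le> j"
  shows "Zgen s t * Zgen i j = Kscale (kq\<^sup>2 * (kp s i)\<^sup>2 * (kr t j)\<^sup>2) (Zgen i j * Zgen s t)"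
proof -
  have "fZ s t * fZ i j - fconst (kq\<^sup>2 * (kp s i)\<^sup>2 * inverse ((kr j t)\<^sup>2)) * fZ i j * fZ s t \<in> relators"
    unfolding relators_def
    by (rule UnI1, rule UnI2, rule CollectI, rule exI[of _ s], rule exI[of _ t], rule exI[of _ i],
        rule exI[of _ j], intro conjI refl assms)
  from relator_eq_0[OF this] show ?thesis
    by (simp add: abs_qmat_simps Kscale_def mult.assoc kr_swap[of t j] power_inverse)
qed

lemma Zgen_rel3: "Zgen i t * Zgen i j = Kscale ((kr t j)\<^sup>2) (Zgen i j * Zgen i t)"
proof -
  have "fZ i t * fZ i j - fconst ((kr t j)\<^sup>2) * fZ i j * fZ i t \<in> relators"
    unfolding relators_def
    by (rule UnI2, rule CollectI, rule exI[of _ i], rule exI[of _ j], rule exI[of _ t], intro conjI refl TrueI)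
  from relator_eq_0[OF this] show ?thesis
    by (simp add: abs_qmat_simps Kscale_def mult.assoc)
qed

lemma Zword_append: "Zword (u @ v) = Zword u * Zword v"
  by (simp add: Zword_def)

lemma Zword_Nword:
  fixes w :: "('n::{finite,linorder} \<times> 'n) list"
  shows "Zword w = Kscale (inverse (word_factor w)) (Nword w)"
  using Gamma_nonzero[OF word_factor_in_Gamma[of w]] by (simp add: Nword_def)

text \<open>The normalizing factors of the two words differ by the square of
  \<open>sym_factor\<close>, which is the leading coefficient of the relation; so the leading
  coefficient becomes 1.\<close>

lemma Nword_exchange:
  fixes i j s t :: "'n::{finite,linorder}"
  assumes "(i, j) < (s, t)"
  shows "\<exists>c\<in>ZGamma. Nword (u @ [(s, t), (i, j)] @ v) = Nword (u @ [(i, j), (s, t)] @ v)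
    + (if j < t \<and> i < s then Kscale c (Nword (u @ [(i, t), (s, j)] @ v)) else 0)"
proof -
  obtain M where M: "M \<in> Gamma" "word_factor (u @ [(s, t), (i, j)] @ v) = sym_factor (s, t) (i, j) * M"
    "word_factor (u @ [(i, j), (s, t)] @ v) = sym_factor (i, j) (s, t) * M"
    by (rule word_factor_pair[of u "(s, t)" "(i, j)" v])
  have nz: "sym_factor (i, j) (s, t) \<noteq> 0"
    using Gamma_nonzero[OF sym_factor_in_Gamma] .
  have sq: "sym_factor (s, t) (i, j) * (sym_factor (i, j) (s, t))\<^sup>2 = sym_factor (i, j) (s, t)"
    using nz by (simp add: sym_factor_swap[of "(s, t)" "(i, j)"] power2_eq_square del: sym_factor.simps)
  have wf: "word_factor (u @ [(s, t), (i, j)] @ v) * (sym_factor (i, j) (s, t))\<^sup>2 = word_factor (u @ [(i, j), (s, t)] @ v)"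
  proof -
    have "x * M * y\<^sup>2 = x * y\<^sup>2 * M" for x y by (simp only: mult_ac)
    then show ?thesis unfolding M(2,3) by (simp only: sq)
  qed
  have main: "Kscale (word_factor (u @ [(s, t), (i, j)] @ v))
      (Zword u * (Kscale ((sym_factor (i, j) (s, t))\<^sup>2) (Zgen i j * Zgen s t)) * Zword v)
    = Nword (u @ [(i, j), (s, t)] @ v)"
    unfolding Nword_def Kscale_mult_left Kscale_mult_right Kscale.scale_scale wf
    by (simp add: Zword_def mult.assoc)
  show ?thesis
  proof (cases "j < t \<and> i < s")
    case True
    let ?k = "(kq\<^sup>2 - 1) * (kp s i)\<^sup>2"
    let ?c = "word_factor (u @ [(s, t), (i, j)] @ v) * ?k * inverse (word_factor (u @ [(i, t), (s, j)] @ v))"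
    have "?c \<in> ZGamma"
      by (intro ZGamma_mult ZGamma_diff ZGamma_1 Gamma_subset_ZGamma Gamma_inverse Gamma_power
          word_factor_in_Gamma kq_in_Gamma kp_in_Gamma)
    moreover have "Zgen s t * Zgen i j = Kscale ((sym_factor (i, j) (s, t))\<^sup>2) (Zgen i j * Zgen s t)
        + Kscale ?k (Zgen i t * Zgen s j)"
    proof -
      have "i < s" "j < t" "\<not> t \<le> j" "\<not> s < i" using True by auto
      then have "(sym_factor (i, j) (s, t))\<^sup>2 = (kp s i)\<^sup>2 * (kr t j)\<^sup>2"
        by (simp add: power_mult_distrib)
      then show ?thesis using Zgen_rel1[OF \<open>i < s\<close> \<open>j < t\<close>] by simp
    qed
    then have "Nword (u @ [(s, t), (i, j)] @ v) = Nword (u @ [(i, j), (s, t)] @ v)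
       + Kscale (word_factor (u @ [(s, t), (i, j)] @ v) * ?k) (Zword (u @ [(i, t), (s, j)] @ v))"
      unfolding main[symmetric] unfolding Nword_def Zword_append
      by (simp add: Zword_def distrib_left distrib_right Kscale.scale_right_distrib Kscale_mult_left Kscale_mult_right mult.assoc
          del: sym_factor.simps)
    then have "Nword (u @ [(s, t), (i, j)] @ v) = Nword (u @ [(i, j), (s, t)] @ v)
       + Kscale ?c (Nword (u @ [(i, t), (s, j)] @ v))"
      by (simp only: Zword_Nword[of "u @ [(i, t), (s, j)] @ v"] Kscale.scale_scale)
    ultimately show ?thesis using True by auto
  next
    case False
    then have "Zgen s t * Zgen i j = Kscale ((sym_factor (i, j) (s, t))\<^sup>2) (Zgen i j * Zgen s t)"
    proof (cases "i < s")
      case True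
      then have "t \<le> j" using False by auto
      with True have "(sym_factor (i, j) (s, t))\<^sup>2 = kq\<^sup>2 * (kp s i)\<^sup>2 * (kr t j)\<^sup>2"
        by (simp add: power_mult_distrib)
      then show ?thesis using Zgen_rel2[OF True \<open>t \<le> j\<close>] by simp
    next
      case False
      then have "i = s" using assms by auto
      then show ?thesis by (simp add: Zgen_rel3[of s t j])
    qed
    then have "Nword (u @ [(s, t), (i, j)] @ v) = Nword (u @ [(i, j), (s, t)] @ v)"
      unfolding main[symmetric] unfolding Nword_def Zword_append
      by (simp add: Zword_def mult.assoc del: sym_factor.simps)
    then show ?thesis using False ZGamma_0 by auto
  qed
qed

section \<open>The order on matrices\<close>

definition mat_unit :: "'n \<Rightarrow> 'n \<Rightarrow> 'n nmat" where
  "mat_unit i j = (\<lambda>k l. if k = i \<and> l = j then 1 else 0)"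

text \<open>Splitting off a common part \<open>C\<close> replaces the truncated subtractions of
  \<open>move\<close> by sums, to which the additive \<open>weight\<close> applies.\<close>

lemma move_iff:
  "move A B \<longleftrightarrow> (\<exists>C i j s t. i < s \<and> j < t \<and>
     A = (\<lambda>k l. C k l + mat_unit i j k l + mat_unit s t k l) \<and>
     B = (\<lambda>k l. C k l + mat_unit i t k l + mat_unit s j k l))"
proof
  assume "move A B"
  then obtain i s j t where m: "i < s" "j < t" "A i j \<ge> 1" "A s t \<ge> 1" and
    B: "B = (\<lambda>k l. if (k, l) = (i, j) \<or> (k, l) = (s, t) then A k l - 1
                   else if (k, l) = (i, t) \<or> (k, l) = (s, j) then A k l + 1 else A k l)"
    unfolding move_def by blast
  have ne: "i \<noteq> s" "s \<noteq> i" "j \<noteq> t" "t \<noteq> j" using m(1,2) by auto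
  define C where "C = (\<lambda>k l. if (k, l) = (i, j) \<or> (k, l) = (s, t) then A k l - 1 else A k l)"
  have "A = (\<lambda>k l. C k l + mat_unit i j k l + mat_unit s t k l)"
    using m(3,4) ne by (intro ext) (simp add: C_def mat_unit_def split: if_split_asm)
  moreover have "B = (\<lambda>k l. C k l + mat_unit i t k l + mat_unit s j k l)"
    using m(3,4) ne by (intro ext) (simp add: B C_def mat_unit_def)
  ultimately show "\<exists>C i j s t. i < s \<and> j < t \<and>
     A = (\<lambda>k l. C k l + mat_unit i j k l + mat_unit s t k l) \<and>
     B = (\<lambda>k l. C k l + mat_unit i t k l + mat_unit s j k l)"
    using m by blast
next
  assume "\<exists>C i j s t. i < s \<and> j < t \<and>
     A = (\<lambda>k l. C k l + mat_unit i j k l + mat_unit s t k l) \<and>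
     B = (\<lambda>k l. C k l + mat_unit i t k l + mat_unit s j k l)"
  then obtain C i j s t where m: "i < s" "j < t" and
    AB: "A = (\<lambda>k l. C k l + mat_unit i j k l + mat_unit s t k l)"
     "B = (\<lambda>k l. C k l + mat_unit i t k l + mat_unit s j k l)" by blast
  have ne: "i \<noteq> s" "s \<noteq> i" "j \<noteq> t" "t \<noteq> j" using m(1,2) by auto
  have B: "B = (\<lambda>k l. if (k, l) = (i, j) \<or> (k, l) = (s, t) then A k l - 1
                   else if (k, l) = (i, t) \<or> (k, l) = (s, j) then A k l + 1 else A k l)"
    using ne by (intro ext) (simp add: AB mat_unit_def)
  show "move A B"
    unfolding move_def
    by (rule exI[of _ i], rule exI[of _ s], rule exI[of _ j], rule exI[of _ t])
      (intro conjI m B, simp_all add: AB mat_unit_def)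
qed

section \<open>Numerical invariants of matrices under moves\<close>

definition weight :: "('n \<Rightarrow> 'n \<Rightarrow> nat) \<Rightarrow> 'n::finite nmat \<Rightarrow> nat" where
  "weight c A = (\<Sum>i\<in>UNIV. \<Sum>j\<in>UNIV. A i j * c i j)"

lemma weight_mat_unit: "weight c (\<lambda>k l. A k l + mat_unit i j k l) = weight c A + c i j"
proof -
  have "(\<Sum>k\<in>UNIV. \<Sum>l\<in>UNIV. mat_unit i j k l * c k l) = c i j"
  proof -
    have "(\<Sum>l\<in>UNIV. mat_unit i j k l * c k l) = (if k = i then c i j else 0)" for k
      by (auto simp: mat_unit_def if_distrib[of "\<lambda>x. x * _"] cong: if_cong)
    then show ?thesis by simp
  qed
  then show ?thesis by (simp add: weight_def distrib_right sum.distrib)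
qed

abbreviation height :: "'n::{finite,linorder} nmat \<Rightarrow> nat" where
  "height A \<equiv> weight (\<lambda>i j. row_index i * row_index j) A"

text \<open>The drop is the product of the differences \<open>row_index s - row_index i\<close> and
  \<open>row_index t - row_index j\<close>, both positive.\<close>

lemma move_height: "move A B \<Longrightarrow> height B < height A"
proof -
  assume "move A B"
  then obtain C i j s t where m: "i < s" "j < t" and
    AB: "A = (\<lambda>k l. C k l + mat_unit i j k l + mat_unit s t k l)"
     "B = (\<lambda>k l. C k l + mat_unit i t k l + mat_unit s j k l)" unfolding move_iff by blast
  have "row_index i * row_index t + row_index s * row_index j < row_index i * row_index j + row_index s * row_index t"
  proof -
    obtain d e where d: "row_index s = row_index i + Suc d" and e: "row_index t = row_index j + Suc e"
      using m unfolding row_index_less_iff[symmetric] by (metis less_iff_Suc_add add_Suc_right)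
    show ?thesis unfolding d e by (simp add: algebra_simps)
  qed
  then show ?thesis
    unfolding AB weight_mat_unit by simp
qed

lemma move_total: "move A B \<Longrightarrow> weight (\<lambda>i j. 1) B = weight (\<lambda>i j. 1) A"
  unfolding move_iff by (auto simp: weight_mat_unit)

abbreviation mat_less :: "'n::linorder nmat \<Rightarrow> 'n nmat \<Rightarrow> bool" where
  "mat_less B A \<equiv> mat_le B A \<and> B \<noteq> A"

lemma mat_le_refl: "mat_le A A" by (simp add: mat_le_def)

lemma mat_le_trans: "mat_le C B \<Longrightarrow> mat_le B A \<Longrightarrow> mat_le C A"
  by (simp add: mat_le_def)

text \<open>Every nonempty sequence of moves lowers the height, so \<open>mat_le\<close> is
  antisymmetric and the height can serve as an induction measure.\<close>

lemma mat_less_height: "mat_less B A \<Longrightarrow> height B < height A"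
proof -
  have "B = A \<or> height B < height A" if "move\<^sup>*\<^sup>* A B"
    using that by induction (auto dest: move_height)
  then show "mat_less B A \<Longrightarrow> height B < height A" by (auto simp: mat_le_def)
qed

lemma mat_le_less_trans:
  fixes A B C :: "'n::{finite,linorder} nmat"
  assumes "mat_le C B" "mat_less B A"
  shows "mat_less C A"
proof -
  have "height C \<le> height B" using assms(1) mat_less_height[of C B] by (cases "C = B") auto
  with mat_less_height[OF assms(2)] have "C \<noteq> A" by auto
  then show ?thesis using assms mat_le_trans by blast
qed

lemma finite_funs_into: "finite S \<Longrightarrow> finite {f :: 'a::finite \<Rightarrow> 'b. \<forall>x. f x \<in> S}"
  using finite_set_of_finite_funs[of "UNIV :: 'a set" S] by simp

lemma finite_mat_le: "finite {B. mat_le B A}" for A :: "'n::{finite,linorder} nmat"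
proof -
  \<comment> \<open>Moves preserve the sum of all entries, which therefore bounds each entry of a
    matrix below \<open>A\<close>.\<close>
  define N where "N = weight (\<lambda>i j. 1) A"
  have "B i j \<le> N" if "mat_le B A" for B i j
  proof -
    have "weight (\<lambda>i j. 1) B = N"
      using that unfolding mat_le_def N_def by induction (simp_all add: move_total[simplified])
    moreover have "B i j \<le> (\<Sum>j\<in>UNIV. B i j)" by (rule member_le_sum) auto
    moreover have "(\<Sum>j\<in>UNIV. B i j) \<le> (\<Sum>i\<in>UNIV. \<Sum>j\<in>UNIV. B i j)"
      by (rule member_le_sum[of i UNIV "\<lambda>i. \<Sum>j\<in>UNIV. B i j"]) auto
    ultimately show ?thesis by (simp add: weight_def)
  qed
  then have "{B. mat_le B A} \<subseteq> {B. \<forall>i. B i \<in> {r. \<forall>j. r j \<in> {..N}}}" by auto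
  moreover have "finite {B :: 'n nmat. \<forall>i. B i \<in> {r. \<forall>j. r j \<in> {..N}}}"
    by (intro finite_funs_into finite_atMost)
  ultimately show ?thesis by (rule finite_subset)
qed

section \<open>Straightening and coordinates\<close>

text \<open>The \<open>ZGamma\<close>-span of the normalized monomials strictly below
  \<open>A\<close>, given inductively because \<open>ZGamma\<close> is a set of scalars and not a
  type with a module structure.\<close>

inductive_set low :: "'n::{finite,linorder} nmat \<Rightarrow> 'n qmat set" for A where
  zero: "0 \<in> low A"
| add: "x \<in> low A \<Longrightarrow> c \<in> ZGamma \<Longrightarrow> mat_less B A \<Longrightarrow> Kscale c (Znorm B) + x \<in> low A"

lemma low_add: "x \<in> low A \<Longrightarrow> y \<in> low A \<Longrightarrow> x + y \<in> low A"
  by (induction rule: low.induct) (auto simp: add.assoc intro: low.add)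

lemma low_scale: "x \<in> low A \<Longrightarrow> c \<in> ZGamma \<Longrightarrow> Kscale c x \<in> low A"
  by (induction rule: low.induct)
    (auto simp: Kscale.scale_right_distrib low.zero intro: low.add ZGamma_mult)

lemma low_mono: "x \<in> low B \<Longrightarrow> mat_less B A \<Longrightarrow> x \<in> low A"
proof (induction rule: low.induct)
  case (add x c C)
  have "mat_less C A" by (rule mat_le_less_trans[of C B A]) (use add in blast)+
  then show ?case using add by (auto intro: low.add)
qed (rule low.zero)

lemma low_Znorm: "c \<in> ZGamma \<Longrightarrow> mat_less B A \<Longrightarrow> Kscale c (Znorm B) \<in> low A"
  using low.add[OF low.zero, of c B A] by simp

fun inversions :: "'a::linorder list \<Rightarrow> nat" where
  "inversions [] = 0"
| "inversions (a # w) = length (filter (\<lambda>b. b < a) w) + inversions w"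

lemma inversions_swap:
  assumes "a < b"
  shows "inversions (u @ [b, a] @ v) = Suc (inversions (u @ [a, b] @ v))"
  using assms by (induction u) auto

lemma not_sorted_descent:
  assumes "\<not> sorted w"
  obtains u a b v where "w = u @ [b, a] @ v" "(a :: 'a::linorder) < b"
proof -
  obtain i where i: "Suc i < length w" "w ! Suc i < w ! i"
    using assms by (auto simp: sorted_iff_nth_Suc not_le)
  have "w = take i w @ [w ! i, w ! Suc i] @ drop (Suc (Suc i)) w"
    using i(1) by (simp add: Cons_nth_drop_Suc)
  with i(2) that show thesis by blast
qed

lemma content_pair:
  "content (u @ [(i, j), (s, t)] @ v) = (\<lambda>k l. content (u @ v) k l + mat_unit i j k l + mat_unit s t k l)"
  by (intro ext) (simp add: content_def mat_unit_def)

lemma content_swap: "content (u @ [b, a] @ v) = content (u @ [a, b] @ v)"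
  by (intro ext) (simp add: content_def)

text \<open>Adjacent letters in the wrong order are exchanged; the correction term has a smaller content,
  and otherwise the number of inversions drops.\<close>



lemma straighten: "Nword w - Znorm (content w) \<in> low (content w)"
proof (induction w rule: wf_induct_rule[OF wf_measures[of "[\<lambda>w. height (content w), inversions]"]])
  case (1 w)
  show ?case
  proof (cases "sorted w")
    case True
    then show ?thesis by (simp add: Znorm_eq_Nword sorted_eq_sorted_word low.zero)
  next
    case False
    then obtain u a b v where w: "w = u @ [b, a] @ v" "a < b" by (rule not_sorted_descent)
    obtain i j s t where ab: "a = (i, j)" "b = (s, t)" by (cases a; cases b)
    let ?w1 = "u @ [a, b] @ v"
    have c1: "content ?w1 = content w" by (simp only: w content_swap)
    have "inversions ?w1 < inversions w" using inversions_swap[OF w(2)] by (simp add: w)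
    then have IH1: "Nword ?w1 - Znorm (content w) \<in> low (content w)"
      using 1[of ?w1] c1 by simp
    obtain c where c: "c \<in> ZGamma" "Nword w = Nword ?w1
        + (if j < t \<and> i < s then Kscale c (Nword (u @ [(i, t), (s, j)] @ v)) else 0)"
      using Nword_exchange[of i j s t u v] w by (auto simp: ab)
    show ?thesis
    proof (cases "j < t \<and> i < s")
      case True
      let ?w2 = "u @ [(i, t), (s, j)] @ v"
      have mv: "move (content w) (content ?w2)"
        unfolding move_iff c1[symmetric] ab content_pair
        by (rule exI[of _ "content (u @ v)"], rule exI[of _ i], rule exI[of _ j], rule exI[of _ s], rule exI[of _ t])
          (use True in simp)
      then have h: "height (content ?w2) < height (content w)" by (rule move_height)
      have less: "mat_less (content ?w2) (content w)"
        using mv h by (auto simp: mat_le_def)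
      have "Nword ?w2 - Znorm (content ?w2) \<in> low (content ?w2)"
        using 1[of ?w2] h by simp
      then have "Kscale c (Nword ?w2 - Znorm (content ?w2)) + Kscale c (Znorm (content ?w2)) \<in> low (content w)"
        using less c(1) by (intro low_add low_scale low_Znorm low_mono[OF _ less])
      then have "Kscale c (Nword ?w2) \<in> low (content w)"
        by (simp add: Kscale.scale_right_diff_distrib)
      from low_add[OF IH1 this] show ?thesis
        using c(2) True by (simp add: algebra_simps)
    next
      case False
      then show ?thesis using c(2) IH1 by auto
    qed
  qed
qed

section \<open>Coordinate functionals dual to the normalized monomials\<close>

definition indicator_fun :: "'n::{finite,linorder} nmat \<Rightarrow> (nat \<Rightarrow> 'n \<Rightarrow> int) \<Rightarrow> 'n ratfun" where
  "indicator_fun A B = (if \<forall>i j. B (row_index i) j = int (A i j) then 1 else 0)"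

text \<open>The divisor is the value of the functional at \<open>Znorm A\<close>: the normalization
  of the word times its twist.\<close>

definition coord :: "'n::{finite,linorder} nmat \<Rightarrow> 'n qmat \<Rightarrow> 'n ratfun" where
  "coord A x = qmat_functional (indicator_fun A) x / (word_factor (sorted_word A) * word_twist (sorted_word A))"

lemma coord_add: "coord A (x + y) = coord A x + coord A y"
  by (simp add: coord_def qmat_functional_add add_divide_distrib)

lemma coord_scale: "coord A (Kscale c x) = c * coord A x"
  by (simp add: coord_def qmat_functional_scale)

lemma coord_0 [simp]: "coord A 0 = 0"
  using coord_scale[of A 0 0] by simp

lemma coord_uminus: "coord A (- x) = - coord A x"
  using coord_add[of A x "- x"] by (simp add: eq_neg_iff_add_eq_0 add.commute)

lemma coord_diff: "coord A (x - y) = coord A x - coord A y"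
  using coord_add[of A x "- y"] by (simp add: coord_uminus)

lemma coord_sum: "coord A (\<Sum>i\<in>S. f i) = (\<Sum>i\<in>S. coord A (f i))"
  by (induction S rule: infinite_finite_induct) (simp_all add: coord_add)

lemma coord_Znorm: "coord A (Znorm B) = (if A = B then 1 else 0)"
proof -
  \<comment> \<open>Lexicographic order makes the rows weakly increasing, as
    \<open>word_op_eval\<close> requires.\<close>
  have "sorted (map fst (sorted_word B))"
    using sorted_sorted_word[of B] unfolding sorted_map
    by (rule sorted_wrt_mono_rel[rotated]) (auto simp: less_eq_prod_def)
  then have "qmat_functional (indicator_fun A) (Znorm B) =
      word_factor (sorted_word B) * (word_twist (sorted_word B) * indicator_fun A (word_content (sorted_word B)))"
    by (simp add: Znorm_eq_Nword Nword_def qmat_functional_scale qmat_functional_Zword pbw_word_def word_op_eval)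
  moreover have "word_content (sorted_word B) (row_index i) j = int (B i j)" for i j
    using fun_cong[OF fun_cong[OF content_sorted_word[of B]], of i j]
    by (simp add: word_content_eq content_def)
  then have "indicator_fun A (word_content (sorted_word B)) = (if A = B then 1 else 0)"
    by (auto simp: indicator_fun_def fun_eq_iff)
  ultimately show ?thesis
    using Gamma_nonzero[OF word_factor_in_Gamma[of "sorted_word B"]] by (simp add: coord_def word_twist_nonzero)
qed

lemma abs_qmat_single: "abs_qmat (Poly_Mapping.single w c) = Kscale c (Zword (ncword w))"
  by (cases w)
    (simp add: Kscale_def Zword_eq_abs_qmat Kconst.abs_eq times_qmat.abs_eq fconst_def mult_single)

lemma qmat_Zword_induct [case_names zero word add]:
  assumes "P 0" "\<And>c w. P (Kscale c (Zword w))" "\<And>x y. P x \<Longrightarrow> P y \<Longrightarrow> P (x + y)"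
  shows "P (x :: 'n::linorder qmat)"
proof -
  have "P (abs_qmat f)" for f :: "'n free_alg"
  proof (induction f rule: poly_mapping_additive_induct)
    case (add f g)
    then show ?case using assms(3) by (simp add: abs_qmat_simps)
  qed (use assms in \<open>simp_all add: abs_qmat_single flip: zero_qmat.abs_eq\<close>)
  then show ?thesis by (metis Quotient_abs_rep[OF Quotient_qmat])
qed

lemma low_subset_span: "x \<in> low A \<Longrightarrow> x \<in> Kscale.span (range Znorm)"
  by (induction rule: low.induct) (auto intro!: Kscale.span_add Kscale.span_scale intro: Kscale.span_base Kscale.span_zero)

lemma span_Znorm: "Kscale.span (range Znorm) = UNIV"
proof -
  have "x \<in> Kscale.span (range Znorm)" for x :: "'a qmat"
  proof (induction x rule: qmat_Zword_induct)
    case (word c w)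
    have "(Nword w - Znorm (content w)) + Znorm (content w) \<in> Kscale.span (range Znorm)"
      by (intro Kscale.span_add low_subset_span[OF straighten] Kscale.span_base) simp
    then show ?case
      by (simp add: Zword_Nword Kscale.span_scale)
  qed (auto intro: Kscale.span_add Kscale.span_zero)
  then show ?thesis by blast
qed

lemma qmat_Znorm_induct [case_names zero add]:
  assumes "P 0" "\<And>c B x. P x \<Longrightarrow> P (Kscale c (Znorm B) + x)"
  shows "P (x :: 'n::{finite,linorder} qmat)"
proof -
  have "x \<in> Kscale.span (range Znorm)" by (simp add: span_Znorm)
  then show ?thesis
    by (induction rule: Kscale.span_induct_alt) (use assms in auto)
qed

lemma finite_coord_support: "finite {B. coord B x \<noteq> 0}"
proof (induction x rule: qmat_Znorm_induct)
  case (add c B x)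
  show ?case
    by (rule finite_subset[OF _ finite.insertI[OF add, of B]]) (auto simp: coord_add coord_scale coord_Znorm)
qed simp

lemma coord_expansion:
  assumes "finite S" "{B. coord B x \<noteq> 0} \<subseteq> S"
  shows "x = (\<Sum>B\<in>S. Kscale (coord B x) (Znorm B))"
proof -
  have expand: "(\<Sum>B\<in>S. Kscale (coord B x) (Znorm B)) = (\<Sum>B\<in>T. Kscale (coord B x) (Znorm B))"
    if "finite S" "S \<subseteq> T" "finite T" "{B. coord B x \<noteq> 0} \<subseteq> S" for S T x
    using that by (intro sum.mono_neutral_left) auto
  have "\<exists>S. finite S \<and> {B. coord B x \<noteq> 0} \<subseteq> S \<and> x = (\<Sum>B\<in>S. Kscale (coord B x) (Znorm B))"
  proof (induction x rule: qmat_Znorm_induct)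
    case zero
    show ?case by (intro exI[of _ "{}"]) simp
  next
    case (add c B x)
    then obtain S where S: "finite S" "{B. coord B x \<noteq> 0} \<subseteq> S" "x = (\<Sum>B\<in>S. Kscale (coord B x) (Znorm B))"
      by blast
    then have x: "x = (\<Sum>C\<in>insert B S. Kscale (coord C x) (Znorm C))"
      using expand[of S "insert B S" x] by auto
    have "(\<Sum>C\<in>insert B S. Kscale (coord C (Kscale c (Znorm B) + x)) (Znorm C)) =
       (\<Sum>C\<in>insert B S. if C = B then Kscale c (Znorm B) else 0) + (\<Sum>C\<in>insert B S. Kscale (coord C x) (Znorm C))"
      unfolding sum.distrib[symmetric]
      by (intro sum.cong) (auto simp: coord_add coord_scale coord_Znorm Kscale.scale_left_distrib)
    also have "\<dots> = Kscale c (Znorm B) + x"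
      using S(1) x by simp
    finally show ?case
      using S(1,2) by (intro exI[of _ "insert B S"]) (auto simp: coord_add coord_scale coord_Znorm)
  qed
  then obtain T where T: "finite T" "{B. coord B x \<noteq> 0} \<subseteq> T" "x = (\<Sum>B\<in>T. Kscale (coord B x) (Znorm B))"
    by blast
  then have "x = (\<Sum>B\<in>S \<union> T. Kscale (coord B x) (Znorm B))"
    using expand[of T "S \<union> T" x] assms by simp
  then show ?thesis
    using expand[of S "S \<union> T" x] assms T by simp
qed

text \<open>Since the \<open>Znorm B\<close> span, the coordinates determine an element; bar
  invariance can then be tested coordinatewise.\<close>

lemma coord_ext: "(\<And>B. coord B x = coord B y) \<Longrightarrow> x = y"
  using coord_expansion[of "{B. coord B x \<noteq> 0}" x] coord_expansion[of "{B. coord B x \<noteq> 0}" y]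
    finite_coord_support[of x] by simp

lemma coord_low:
  assumes "x \<in> low A"
  shows "coord B x \<in> ZGamma" and "coord B x \<noteq> 0 \<Longrightarrow> mat_less B A"
  using assms
  by (induction rule: low.induct)
    (auto simp: coord_add coord_scale coord_Znorm ZGamma_0 ZGamma_add split: if_splits)

section \<open>The bar involution on the algebra\<close>

text \<open>Values lie in the quotient from the start, where the relations that reorder reversed
  words already hold.\<close>

definition bar_free :: "'n::{finite,linorder} free_alg \<Rightarrow> 'n qmat" where
  "bar_free = pm_lift (\<lambda>w c. Kscale (Kbar c) (Zword (rev (ncword w))))"

lemma bar_free_add: "bar_free (x + y) = bar_free x + bar_free y"
  unfolding bar_free_def by (rule pm_lift_add) (simp_all add: Kbar_add Kscale.scale_left_distrib)

lemma bar_free_single: "bar_free (Poly_Mapping.single w c) = Kscale (Kbar c) (Zword (rev (ncword w)))"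
  by (simp add: bar_free_def pm_lift_single)

lemma bar_free_0: "bar_free 0 = 0"
  by (simp add: bar_free_def)

lemma bar_free_diff: "bar_free (x - y) = bar_free x - bar_free y"
  using bar_free_add[of "x - y" y] by simp

lemma bar_free_mult: "bar_free (x * y) = bar_free y * bar_free x"
proof (induction x rule: poly_mapping_additive_induct)
  case (single u c)
  show ?case
  proof (induction y rule: poly_mapping_additive_induct)
    case (single v d)
    show ?case
      by (simp add: mult_single bar_free_single ncword_add Zword_append Kbar_mult Kscale_mult_left Kscale_mult_right mult.commute)
  qed (simp_all add: bar_free_0 bar_free_add distrib_left distrib_right)
qed (simp_all add: bar_free_0 bar_free_add distrib_left distrib_right)

lemma bar_free_fZ: "bar_free (fZ i j) = Zgen i j"
  by (simp add: fZ_def bar_free_single Zword_def)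

lemma bar_free_fconst: "bar_free (fconst c) = Kconst (Kbar c)"
  by (simp add: fconst_def bar_free_single Zword_def Kscale_def zero_ncmon_def)

lemma Kbar_kq: "Kbar kq = inverse kq" and Kbar_kp: "Kbar (kp i j) = inverse (kp i j)"
  and Kbar_kr: "Kbar (kr i j) = inverse (kr i j)"
  by (simp_all add: Kbar_Gamma kq_in_Gamma kp_in_Gamma kr_in_Gamma)

lemma bar_free_relator:
  assumes "r \<in> relators"
  shows "bar_free r = 0"
  using assms unfolding relators_def
proof (elim UnE CollectE exE conjE)
  fix s t i j :: 'a
  assume ij: "i < s" "j < t" and r: "r = fZ s t * fZ i j
    - (fconst ((kp s i)\<^sup>2 * (kr t j)\<^sup>2) * fZ i j * fZ s t
       + fconst ((kq\<^sup>2 - 1) * (kp s i)\<^sup>2) * fZ i t * fZ s j)"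
  have "bar_free r = Zgen i j * Zgen s t
      - (Kscale (Kbar ((kp s i)\<^sup>2 * (kr t j)\<^sup>2)) (Zgen s t * Zgen i j)
         + Kscale (Kbar ((kq\<^sup>2 - 1) * (kp s i)\<^sup>2)) (Zgen s j * Zgen i t))"
    by (simp add: r bar_free_diff bar_free_add bar_free_mult bar_free_fZ bar_free_fconst
        Kscale_def Kconst_commute mult.assoc[symmetric])
  \<comment> \<open>Reversal also puts the letters of the correction term in the wrong order.
    Reordering them yields \<open>kq\<^sup>2\<close>, and \<open>inverse (kq\<^sup>2) - 1\<close>
    times it is \<open>1 - kq\<^sup>2\<close>, which cancels the correction from the leading
    product.\<close>
  also have "Zgen s j * Zgen i t = Kscale (kq\<^sup>2 * (kp s i)\<^sup>2 * (kr j t)\<^sup>2) (Zgen i t * Zgen s j)"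
    using ij by (intro Zgen_rel2) auto
  also have "Zgen s t * Zgen i j = Kscale ((kp s i)\<^sup>2 * (kr t j)\<^sup>2) (Zgen i j * Zgen s t)
    + Kscale ((kq\<^sup>2 - 1) * (kp s i)\<^sup>2) (Zgen i t * Zgen s j)"
    by (rule Zgen_rel1[OF ij])
  finally have "bar_free r = Zgen i j * Zgen s t
      - (Kscale (Kbar ((kp s i)\<^sup>2 * (kr t j)\<^sup>2) * ((kp s i)\<^sup>2 * (kr t j)\<^sup>2)) (Zgen i j * Zgen s t)
         + Kscale (Kbar ((kp s i)\<^sup>2 * (kr t j)\<^sup>2) * ((kq\<^sup>2 - 1) * (kp s i)\<^sup>2) +
             Kbar ((kq\<^sup>2 - 1) * (kp s i)\<^sup>2) * (kq\<^sup>2 * (kp s i)\<^sup>2 * (kr j t)\<^sup>2)) (Zgen i t * Zgen s j))"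
    by (simp add: Kscale.scale_right_distrib Kscale.scale_left_distrib)
  moreover have "Kbar ((kp s i)\<^sup>2 * (kr t j)\<^sup>2) * ((kp s i)\<^sup>2 * (kr t j)\<^sup>2) = 1"
    by (simp add: Kbar_mult Kbar_power Kbar_kp Kbar_kr power_inverse field_simps)
  moreover have "Kbar ((kp s i)\<^sup>2 * (kr t j)\<^sup>2) * ((kq\<^sup>2 - 1) * (kp s i)\<^sup>2) +
             Kbar ((kq\<^sup>2 - 1) * (kp s i)\<^sup>2) * (kq\<^sup>2 * (kp s i)\<^sup>2 * (kr j t)\<^sup>2) = 0"
    by (simp add: Kbar_mult Kbar_power Kbar_diff Kbar_kp Kbar_kr Kbar_kq kr_swap[of j t] power_inverse field_simps)
  ultimately show ?thesis by simp
next
  fix s t i j :: 'a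
  assume ij: "i < s" "t \<le> j" and r: "r = fZ s t * fZ i j
        - fconst (kq\<^sup>2 * (kp s i)\<^sup>2 * inverse ((kr j t)\<^sup>2)) * fZ i j * fZ s t"
  have "bar_free r = Zgen i j * Zgen s t
      - Kscale (Kbar (kq\<^sup>2 * (kp s i)\<^sup>2 * inverse ((kr j t)\<^sup>2))) (Zgen s t * Zgen i j)"
    by (simp add: r bar_free_diff bar_free_add bar_free_mult bar_free_fZ bar_free_fconst
        Kscale_def Kconst_commute mult.assoc[symmetric])
  also have "Zgen s t * Zgen i j = Kscale (kq\<^sup>2 * (kp s i)\<^sup>2 * (kr t j)\<^sup>2) (Zgen i j * Zgen s t)"
    using ij by (rule Zgen_rel2)
  finally have "bar_free r = Zgen i j * Zgen s t
      - Kscale (Kbar (kq\<^sup>2 * (kp s i)\<^sup>2 * inverse ((kr j t)\<^sup>2)) * (kq\<^sup>2 * (kp s i)\<^sup>2 * (kr t j)\<^sup>2)) (Zgen i j * Zgen s t)"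
    by simp
  moreover have "Kbar (kq\<^sup>2 * (kp s i)\<^sup>2 * inverse ((kr j t)\<^sup>2)) * (kq\<^sup>2 * (kp s i)\<^sup>2 * (kr t j)\<^sup>2) = 1"
    unfolding Kbar_mult Kbar_power Kbar_inverse Kbar_kp Kbar_kr Kbar_kq
    by (simp add: kr_swap[of t j] power_inverse field_simps)
  ultimately show ?thesis by simp
next
  fix i j t :: 'a
  assume r: "r = fZ i t * fZ i j - fconst ((kr t j)\<^sup>2) * fZ i j * fZ i t"
  have "bar_free r = Zgen i j * Zgen i t - Kscale (Kbar ((kr t j)\<^sup>2)) (Zgen i t * Zgen i j)"
    by (simp add: r bar_free_diff bar_free_add bar_free_mult bar_free_fZ bar_free_fconst
        Kscale_def Kconst_commute mult.assoc[symmetric])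
  also have "Zgen i t * Zgen i j = Kscale ((kr t j)\<^sup>2) (Zgen i j * Zgen i t)"
    by (rule Zgen_rel3)
  finally show ?thesis
    by (simp add: Kbar_power Kbar_kr power_inverse)
qed

lemma bar_free_ideal: "x \<in> two_sided_ideal relators \<Longrightarrow> bar_free x = 0"
  by (induction rule: two_sided_ideal.induct)
    (simp_all add: bar_free_0 bar_free_add bar_free_mult bar_free_relator)

definition bar_map :: "'n::{finite,linorder} qmat \<Rightarrow> 'n qmat" where
  "bar_map x = bar_free (rep_qmat x)"

lemma bar_map_abs: "bar_map (abs_qmat f) = bar_free f"
proof -
  have "cong_rel (rep_qmat (abs_qmat f)) f"
    by (metis Quotient_qmat Quotient_abs_rep qmat.abs_eq_iff)
  then have "bar_free (rep_qmat (abs_qmat f) - f) = 0"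
    unfolding cong_rel_def by (rule bar_free_ideal)
  then show ?thesis by (simp add: bar_map_def bar_free_diff)
qed

lemma abs_qmat_cases: obtains f where "x = abs_qmat f"
  by (metis Quotient_abs_rep[OF Quotient_qmat])

lemma bar_map_add: "bar_map (x + y) = bar_map x + bar_map y"
  by (cases x rule: abs_qmat_cases, cases y rule: abs_qmat_cases)
    (simp add: bar_map_abs bar_free_add flip: abs_qmat_simps)

lemma bar_map_mult: "bar_map (x * y) = bar_map y * bar_map x"
  by (cases x rule: abs_qmat_cases, cases y rule: abs_qmat_cases)
    (simp add: bar_map_abs bar_free_mult flip: abs_qmat_simps)

lemma bar_map_0 [simp]: "bar_map 0 = 0"
  using bar_map_add[of 0 0] by simp

lemma bar_map_Zgen: "bar_map (Zgen i j) = Zgen i j"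
  by (simp add: bar_map_abs bar_free_fZ flip: abs_qmat_simps)

lemma bar_map_Kconst: "bar_map (Kconst c) = Kconst (Kbar c)"
  by (simp add: bar_map_abs bar_free_fconst flip: abs_qmat_simps)

lemma bar_map_Kscale: "bar_map (Kscale c x) = Kscale (Kbar c) (bar_map x)"
  by (simp add: Kscale_def bar_map_mult bar_map_Kconst Kconst_commute)

lemma anti_hom_Zword:
  assumes "\<And>x y. f (x * y) = f y * f x" "f 1 = 1" "\<And>i j. f (Zgen i j) = Zgen i j"
  shows "f (Zword w) = Zword (rev w)"
proof (induction w)
  case (Cons a w)
  have "Zword (a # w) = Zgen (fst a) (snd a) * Zword w" by (simp add: Zword_def case_prod_unfold)
  then show ?case by (simp add: assms Cons Zword_append) (simp add: Zword_def case_prod_unfold)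
qed (simp add: Zword_def assms)

lemma bar_map_1 [simp]: "bar_map 1 = 1"
  using bar_map_Kconst[of 1] by simp

lemma bar_map_Zword: "bar_map (Zword w) = Zword (rev w)"
  by (rule anti_hom_Zword) (simp_all add: bar_map_mult bar_map_Zgen)

lemma bar_map_bar_map [simp]: "bar_map (bar_map x) = x"
  by (induction x rule: qmat_Zword_induct) (simp_all add: bar_map_Kscale bar_map_Zword bar_map_add)

lemma is_bar_bar_map: "is_bar bar_map"
proof -
  have "bij bar_map"
    by (rule o_bij[of bar_map]) (auto simp: fun_eq_iff)
  moreover have "inverse (kp i j) = kp j i" "inverse (kr i j) = kr j i" for i j :: 'a
    by (simp_all add: kp_swap[of j i] kr_swap[of j i])
  ultimately show ?thesis
    by (simp add: is_bar_def bar_map_add bar_map_mult bar_map_Kscale bar_map_Zgen bar_map_Kconst Kbar_kq Kbar_kp Kbar_kr)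
qed

text \<open>Scalars are central, so an anti-homomorphism is multiplicative on them and determined by
  its values on the parameters; words are reversed because generators are fixed.\<close>

lemma is_bar_unique:
  fixes f :: "'n::{finite,linorder} qmat \<Rightarrow> 'n qmat"
  assumes "is_bar f"
  shows "f = bar_map"
proof
  have add: "f (x + y) = f x + f y" and mult: "f (x * y) = f y * f x" and one: "f 1 = 1" and Zg: "f (Zgen i j) = Zgen i j"
    and rat: "f (Kscale (of_rat r) x) = Kscale (of_rat r) (f x)"
    and q: "f (Kconst kq) = Kconst (inverse kq)" and p: "f (Kconst (kp i j)) = Kconst (kp j i)"
    and r: "f (Kconst (kr i j)) = Kconst (kr j i)" for x y i j r
    using assms unfolding is_bar_def by blast+
  have K: "f (Kconst c) = Kconst (Kbar c)" for c
  proof (rule ratfun_hom_eqI[of "\<lambda>c. f (Kconst c)" "\<lambda>c. Kconst (Kbar c)"])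
    show "f (Kconst (x * y)) = f (Kconst x) * f (Kconst y)" for x y
      by (metis mult.commute Kconst_mult mult)
    show "f (Kconst (of_rat r)) = Kconst (Kbar (of_rat r))" for r
      using rat[of r 1] by (simp add: Kscale_def one)
    show "f (Kconst (Kvar v)) = Kconst (Kbar (Kvar v))" for v
    proof (cases v rule: param_cases)
      case Q
      then show ?thesis using q by (simp add: kq_def Kbar_Kvar)
    next
      case (P i j)
      then show ?thesis using p[of i j] by (auto simp: kp_def Kbar_Kvar)
    next
      case (R i j)
      then show ?thesis using r[of i j] by (auto simp: kr_def Kbar_Kvar)
    qed
  qed (simp_all add: Kconst_add add Kbar_add one Kbar_mult Kconst_mult)
  have 0: "f 0 = 0" using add[of 0 0] by simp
  fix x
  show "f x = bar_map x"
  proof (induction x rule: qmat_Zword_induct)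
    case (word c w)
    have "f (Zword w) = Zword (rev w)" by (rule anti_hom_Zword[OF mult one Zg])
    then show ?case
      by (simp add: Kscale_def mult K Kconst_commute bar_map_mult bar_map_Kconst bar_map_Zword)
  qed (simp_all add: 0 add bar_map_add)
qed

lemma bar_eq_bar_map: "bar = bar_map"
  unfolding bar_def using is_bar_bar_map is_bar_unique by (rule the_equality)

text \<open>Bar reverses the sorted word. This keeps the content, so straightening the reversed word
  gives \<open>Znorm A\<close> as leading term.\<close>

lemma bar_Znorm_low: "bar_map (Znorm A) - Znorm A \<in> low A"
proof -
  have "bar_map (Nword w) = Nword (rev w)" for w :: "('a \<times> 'a) list"
    by (simp add: Nword_def bar_map_Kscale bar_map_Zword word_factor_rev Kbar_Gamma word_factor_in_Gamma)
  moreover have "content (rev (sorted_word A)) = A"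
    using content_sorted_word[of A] by (simp add: content_def)
  ultimately show ?thesis
    using straighten[of "rev (sorted_word A)"] by (simp add: Znorm_eq_Nword)
qed

section \<open>The canonical basis\<close>

lemma finite_max_height:
  assumes "finite S" "S \<noteq> {}"
  shows "\<exists>B\<in>S. \<forall>C\<in>S. height C \<le> height B"
proof -
  have "Max (height ` S) \<in> height ` S" using assms by (intro Max_in) auto
  then obtain B where B: "B \<in> S" "height B = Max (height ` S)" by auto
  have "height C \<le> height B" if "C \<in> S" for C
    unfolding B(2) using assms(1) that by (intro Max_ge) auto
  with B(1) show ?thesis by blast
qed

text \<open>Duality of \<open>coord\<close> and \<open>Znorm\<close> forces the existentially
  quantified coefficients to be the coordinates of \<open>b\<close>.\<close>

lemma is_canonical_iff:
  "is_canonical L A b \<longleftrightarrow> bar_map b = b \<and> coord A b = 1 \<and>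
     (\<forall>B. B \<noteq> A \<longrightarrow> coord B b \<in> Z_Gamma_plus L) \<and> (\<forall>B. coord B b \<noteq> 0 \<longrightarrow> mat_le B A)"
proof
  assume can: "is_canonical L A b"
  then obtain h where h: "\<And>B. B \<noteq> A \<Longrightarrow> h B \<in> Z_Gamma_plus L" "\<And>B. B \<noteq> A \<Longrightarrow> h B \<noteq> 0 \<Longrightarrow> mat_le B A"
    and fin: "finite {B. B \<noteq> A \<and> h B \<noteq> 0}"
    and b: "b = Znorm A + (\<Sum>B \<in> {B. B \<noteq> A \<and> h B \<noteq> 0}. Kscale (h B) (Znorm B))"
    unfolding is_canonical_def by blast
  have "coord B b = (if B = A then 1 else h B)" for B
    using fin by (auto simp: b coord_add coord_sum coord_scale coord_Znorm if_distrib[of "\<lambda>x. _ * x"] cong: if_cong)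
  then show "bar_map b = b \<and> coord A b = 1 \<and>
     (\<forall>B. B \<noteq> A \<longrightarrow> coord B b \<in> Z_Gamma_plus L) \<and> (\<forall>B. coord B b \<noteq> 0 \<longrightarrow> mat_le B A)"
    using can h by (auto simp: is_canonical_def bar_eq_bar_map mat_le_refl)
next
  assume can: "bar_map b = b \<and> coord A b = 1 \<and>
     (\<forall>B. B \<noteq> A \<longrightarrow> coord B b \<in> Z_Gamma_plus L) \<and> (\<forall>B. coord B b \<noteq> 0 \<longrightarrow> mat_le B A)"
  have fin: "finite {B. B \<noteq> A \<and> coord B b \<noteq> 0}"
    by (rule finite_subset[OF _ finite_coord_support[of b]]) auto
  have "b = (\<Sum>B\<in>insert A {B. B \<noteq> A \<and> coord B b \<noteq> 0}. Kscale (coord B b) (Znorm B))"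
    using fin by (intro coord_expansion) auto
  then have "b = Znorm A + (\<Sum>B \<in> {B. B \<noteq> A \<and> coord B b \<noteq> 0}. Kscale (coord B b) (Znorm B))"
    using fin can by simp
  then show "is_canonical L A b"
    unfolding is_canonical_def bar_eq_bar_map using can fin by (intro conjI exI[of _ "\<lambda>B. coord B b"]) auto
qed

lemma bar_map_sum: "bar_map (\<Sum>i\<in>S. f i) = (\<Sum>i\<in>S. bar_map (f i))"
  by (induction S rule: infinite_finite_induct) (simp_all add: bar_map_add)

lemma bar_map_diff: "bar_map (x - y) = bar_map x - bar_map y"
  using bar_map_add[of "x - y" y] by simp

text \<open>By unitriangularity the bar image of \<open>Znorm C\<close> has a nonzero coordinate at
  \<open>B\<close> only if \<open>B\<close> is \<open>C\<close> or below it; maximality leaves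
  \<open>C = B\<close>, with coefficient 1.\<close>

lemma coord_bar_map_maximal:
  assumes "\<And>C. coord C x \<noteq> 0 \<Longrightarrow> \<not> mat_less B C"
  shows "coord B (bar_map x) = Kbar (coord B x)"
proof -
  let ?S = "insert B {C. coord C x \<noteq> 0}"
  have fin: "finite ?S" using finite_coord_support[of x] by simp
  have "coord B (bar_map x) = (\<Sum>C\<in>?S. Kbar (coord C x) * coord B (bar_map (Znorm C)))"
    by (subst coord_expansion[OF fin, of x]) (auto simp: bar_map_sum bar_map_Kscale coord_sum coord_scale)
  also have "\<dots> = (\<Sum>C\<in>?S. if C = B then Kbar (coord B x) else 0)"
  proof (rule sum.cong[OF refl])
    fix C assume "C \<in> ?S"
    then have "coord B (bar_map (Znorm C) - Znorm C) = 0"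
      using assms[of C] coord_low(2)[OF bar_Znorm_low[of C], of B] by auto
    then show "Kbar (coord C x) * coord B (bar_map (Znorm C)) = (if C = B then Kbar (coord B x) else 0)"
      by (auto simp: coord_diff coord_Znorm)
  qed
  finally show ?thesis using fin by simp
qed

text \<open>The coefficients of a bar-invariant element are corrected one at a time, from the top down:
  \<open>J\<close> is the set of indices at which \<open>x\<close> may still fail to be invariant.\<close>

lemma canonical_exists_aux:
  assumes "set L = UNIV" "finite J" "\<And>B. B \<in> J \<Longrightarrow> mat_less B A" "\<And>B C. B \<in> J \<Longrightarrow> mat_less C B \<Longrightarrow> C \<in> J"
    and "\<And>B. coord B (bar_map x - x) \<in> ZGamma" "\<And>B. coord B (bar_map x - x) \<noteq> 0 \<Longrightarrow> B \<in> J"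
    and "coord A x = 1" "\<And>B. B \<noteq> A \<Longrightarrow> coord B x \<in> Z_Gamma_plus L" "\<And>B. coord B x \<noteq> 0 \<Longrightarrow> mat_le B A"
  shows "\<exists>b. is_canonical L A b"
  using assms(2-)
proof (induction "card J" arbitrary: J x)
  case 0
  then have "coord B (bar_map x - x) = 0" for B by auto
  then have "bar_map x - x = 0" by (intro coord_ext) simp
  then show ?case using 0 by (intro exI[of _ x]) (simp add: is_canonical_iff)
next
  case (Suc n)
  then have "J \<noteq> {}" by auto
  with Suc.prems(1) obtain B where B: "B \<in> J" "\<And>C. C \<in> J \<Longrightarrow> height C \<le> height B"
    using finite_max_height by metis
  \<comment> \<open>The defect of invariance is anti-invariant, and hence so is its coordinate at
    the maximal index \<open>B\<close>.\<close>
  define y where "y = bar_map x - x"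
  have y: "coord C y \<in> ZGamma" "coord C y \<noteq> 0 \<Longrightarrow> C \<in> J" for C
    using Suc.prems by (auto simp: y_def)
  have "bar_map y = - y" by (simp add: y_def bar_map_diff)
  moreover have "coord B (bar_map y) = Kbar (coord B y)"
  proof (rule coord_bar_map_maximal)
    show "\<not> mat_less B C" if "coord C y \<noteq> 0" for C
      using B(2)[OF y(2)[OF that]] mat_less_height[of B C] by auto
  qed
  ultimately have "Kbar (coord B y) = - coord B y" by (simp add: coord_uminus)
  then obtain h where h: "h \<in> Z_Gamma_plus L" "coord B y = h - Kbar h"
    using Kbar_antiinvariant_ZGamma[OF assms(1) y(1)] by metis
  \<comment> \<open>This changes the defect at \<open>B\<close> by \<open>Kbar h - h\<close>, which
    is \<open>- coord B y\<close>; other coordinates change only strictly below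
    \<open>B\<close>.\<close>
  define x' where "x' = x + Kscale h (Znorm B)"
  define z where "z = bar_map (Znorm B) - Znorm B"
  have z: "coord C z \<in> ZGamma" "coord C z \<noteq> 0 \<Longrightarrow> mat_less C B" for C
    using coord_low[OF bar_Znorm_low[of B]] by (auto simp: z_def)
  have eq: "bar_map x' - x' = y + Kscale (Kbar h) (bar_map (Znorm B)) - Kscale h (Znorm B)"
    by (simp add: x'_def y_def bar_map_add bar_map_Kscale)
  have y': "coord C (bar_map x' - x') = coord C y - (if C = B then coord B y else 0) + Kbar h * coord C z" for C
    unfolding eq z_def coord_add coord_diff coord_scale coord_Znorm h(2) by (simp add: algebra_simps)
  have J: "mat_less B A" using Suc.prems B by blast
  show ?case
  proof (rule Suc.hyps(1)[of "J - {B}" x'])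
    show "n = card (J - {B})" using Suc.hyps(2) B Suc.prems(1) by simp
    show "finite (J - {B})" using Suc.prems by simp
    show "mat_less C A" if "C \<in> J - {B}" for C using that Suc.prems by blast
    \<comment> \<open>Removing \<open>B\<close> preserves downward closure because no element of
      \<open>J\<close> has greater height than \<open>B\<close>.\<close>
    show "D \<in> J - {B}" if "C \<in> J - {B}" "mat_less D C" for C D
      using that Suc.prems(3)[of C D] B(2)[of C] mat_less_height[of D C] by auto
    show "coord C (bar_map x' - x') \<in> ZGamma" for C
      using ZGamma_Kbar[OF Z_Gamma_plus_subset_ZGamma[OF h(1)]]
      by (simp add: y' y z ZGamma_add ZGamma_diff ZGamma_mult ZGamma_0)
    show "C \<in> J - {B}" if "coord C (bar_map x' - x') \<noteq> 0" for C
    proof (cases "C = B")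
      case True
      with that z(2)[of B] show ?thesis unfolding y' by auto
    next
      case False
      with that have "coord C y \<noteq> 0 \<or> coord C z \<noteq> 0" unfolding y' by auto
      with False show ?thesis using y(2) z(2) Suc.prems(3)[OF B(1)] by blast
    qed
    show "coord A x' = 1" using Suc.prems(6) J by (auto simp: x'_def coord_add coord_scale coord_Znorm)
    show "coord C x' \<in> Z_Gamma_plus L" if "C \<noteq> A" for C
      using Suc.prems that h(1) by (auto simp: x'_def coord_add coord_scale coord_Znorm intro: Z_Gamma_plus_add)
    show "mat_le C A" if "coord C x' \<noteq> 0" for C
      using that Suc.prems J by (auto simp: x'_def coord_add coord_scale coord_Znorm split: if_splits)
  qed
qed

lemma canonical_exists:
  assumes "set L = UNIV"
  shows "\<exists>b. is_canonical L A b"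
proof (rule canonical_exists_aux[of L "{B. mat_less B A}" A "Znorm A", OF assms])
  show "finite {B. mat_less B A}"
    by (rule finite_subset[OF _ finite_mat_le[of A]]) auto
  show "C \<in> {B. mat_less B A}" if "B \<in> {B. mat_less B A}" "mat_less C B" for B C
    using that mat_le_less_trans[of C B A] by blast
  show "coord B (bar_map (Znorm A) - Znorm A) \<in> ZGamma"
    "coord B (bar_map (Znorm A) - Znorm A) \<noteq> 0 \<Longrightarrow> B \<in> {B. mat_less B A}" for B
    using coord_low[OF bar_Znorm_low[of A], of B] by auto
qed (auto simp: coord_Znorm mat_le_refl Z_Gamma_plus_0 split: if_splits)

lemma maximal_coord:
  assumes "x \<noteq> 0"
  shows "\<exists>B. coord B x \<noteq> 0 \<and> (\<forall>C. coord C x \<noteq> 0 \<longrightarrow> \<not> mat_less B C)"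
proof -
  have "{B. coord B x \<noteq> 0} \<noteq> {}" using assms coord_ext[of x 0] by auto
  with finite_coord_support obtain B where
    B: "B \<in> {B. coord B x \<noteq> 0}" "\<And>C. C \<in> {B. coord B x \<noteq> 0} \<Longrightarrow> height C \<le> height B"
    using finite_max_height by metis
  have "\<not> mat_less B C" if "coord C x \<noteq> 0" for C
    using B(2)[of C] mat_less_height[of B C] that by auto
  with B(1) show ?thesis by blast
qed

lemma canonical_unique:
  assumes "is_canonical L A b" "is_canonical L A b'"
  shows "b = b'"
proof (rule ccontr)
  assume "b \<noteq> b'"
  then have "b - b' \<noteq> 0" by simp
  then obtain B where B: "coord B (b - b') \<noteq> 0" "\<And>C. coord C (b - b') \<noteq> 0 \<Longrightarrow> \<not> mat_less B C"
    using maximal_coord by blast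
  have "coord B (bar_map (b - b')) = Kbar (coord B (b - b'))"
    using B(2) by (rule coord_bar_map_maximal)
  then have "Kbar (coord B (b - b')) = coord B (b - b')"
    using assms by (simp add: is_canonical_iff bar_map_diff)
  \<comment> \<open>At \<open>A\<close> both coordinates are 1, so their difference is 0.\<close>
  moreover have "coord B (b - b') \<in> Z_Gamma_plus L"
    using assms by (cases "B = A") (auto simp: is_canonical_iff coord_diff Z_Gamma_plus_0 intro: Z_Gamma_plus_diff)
  ultimately show False
    using Kbar_invariant_Z_Gamma_plus B(1) by blast
qed

text \<open>A linear relation is tested at an index of maximal height, where only the diagonal
  coordinate survives. Spanning follows by solving for \<open>Znorm A\<close>, by induction on
  height.\<close>

lemma unitriangular_basis:
  fixes b :: "'n::{finite,linorder} nmat \<Rightarrow> 'n qmat"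
  assumes diag: "\<And>A. coord A (b A) = 1" and tri: "\<And>A B. coord B (b A) \<noteq> 0 \<Longrightarrow> mat_le B A"
  shows "is_K_basis (range b)"
  unfolding is_K_basis_def
proof
  \<comment> \<open>Elements of the range must correspond to single matrices before a relation among
    them can be compared by height; antisymmetry of \<open>mat_le\<close> provides this.\<close>
  have inj: "A = B" if "b A = b B" for A B
  proof -
    have "mat_le A B" "mat_le B A"
      using tri[of A B] tri[of B A] diag[of A] diag[of B] by (simp_all add: that)
    then show ?thesis using mat_less_height[of A B] mat_less_height[of B A] by force
  qed
  show "\<not> Kscale.dependent (range b)"
  proof
    assume "Kscale.dependent (range b)"
    then obtain T u where T: "finite T" "T \<subseteq> range b" "(\<Sum>v\<in>T. Kscale (u v) v) = 0" "\<exists>v\<in>T. u v \<noteq> 0"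
      unfolding Kscale.dependent_explicit by blast
    define S where "S = {A. b A \<in> T \<and> u (b A) \<noteq> 0}"
    have "finite S"
      unfolding S_def using T(1) inj by (intro finite_subset[OF _ finite_vimageI[of T b]]) (auto intro: injI)
    moreover have "S \<noteq> {}" using T(2,4) by (auto simp: S_def)
    ultimately obtain A where A: "A \<in> S" "\<And>B. B \<in> S \<Longrightarrow> height B \<le> height A"
      using finite_max_height by metis
    have "0 = (\<Sum>v\<in>T. u v * coord A v)"
      using arg_cong[OF T(3), of "coord A"] by (simp add: coord_sum coord_scale)
    also have "\<dots> = (\<Sum>v\<in>T. if v = b A then u (b A) else 0)"
    proof (rule sum.cong[OF refl])
      fix v assume v: "v \<in> T"
      with T(2) obtain B where B: "v = b B" by auto
      show "u v * coord A v = (if v = b A then u (b A) else 0)"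
      proof (cases "B = A \<or> u v = 0")
        case True
        then show ?thesis using B diag by auto
      next
        case False
        then have "height B \<le> height A" using v B A(2)[of B] by (auto simp: S_def)
        then have "coord A (b B) = 0" using tri[of A B] mat_less_height[of A B] False by fastforce
        then show ?thesis using B False inj by auto
      qed
    qed
    also have "\<dots> = u (b A)" using T(1) A(1) by (simp add: S_def)
    finally show False using A(1) by (simp add: S_def)
  qed
  have "Znorm A \<in> Kscale.span (range b)" for A
  proof (induction A rule: measure_induct_rule[of height])
    case (less A)
    let ?S = "{B. coord B (b A) \<noteq> 0}"
    have fin: "finite ?S" by (rule finite_coord_support)
    have "b A = (\<Sum>B\<in>?S. Kscale (coord B (b A)) (Znorm B))"
      using fin by (intro coord_expansion) auto
    also have "\<dots> = Kscale (coord A (b A)) (Znorm A) + (\<Sum>B\<in>?S - {A}. Kscale (coord B (b A)) (Znorm B))"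
      using fin diag by (intro sum.remove) auto
    finally have "Znorm A = b A - (\<Sum>B\<in>?S - {A}. Kscale (coord B (b A)) (Znorm B))"
      unfolding diag by (simp only: Kscale.scale_one add_diff_cancel_right' eq_diff_eq)
    moreover have "\<dots> \<in> Kscale.span (range b)"
    proof (intro Kscale.span_diff Kscale.span_sum Kscale.span_scale)
      show "b A \<in> Kscale.span (range b)" by (intro Kscale.span_base) simp
      show "Znorm B \<in> Kscale.span (range b)" if "B \<in> ?S - {A}" for B
        using that tri[of B A] mat_less_height[of B A] by (intro less) auto
    qed
    ultimately show ?case by simp
  qed
  then have "Kscale.span (range Znorm) \<subseteq> Kscale.span (range b)"
    by (intro Kscale.span_minimal Kscale.subspace_span) auto
  then show "Kscale.span (range b) = UNIV" by (simp add: span_Znorm top.extremum_unique)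
qed

theorem theorem3p5:
  fixes L :: "'n::{finite, linorder} param list"
  assumes "admissible_listing L"
  shows "(\<forall>A :: 'n nmat. \<exists>!b :: 'n qmat. is_canonical L A b) \<and>
         is_K_basis {canonical_elem L A | A :: 'n nmat. True}"
proof
  have ex1: "\<exists>!b. is_canonical L A b" for A :: "'n nmat"
    using canonical_exists[OF admissible_listing_UNIV[OF assms]] canonical_unique by blast
  then show "\<forall>A :: 'n nmat. \<exists>!b. is_canonical L A b" by blast
  have "is_canonical L A (canonical_elem L A)" for A :: "'n nmat"
    unfolding canonical_elem_def by (rule theI'[OF ex1])
  then have "is_K_basis (range (canonical_elem L))"
    by (intro unitriangular_basis) (simp_all add: is_canonical_iff)
  then show "is_K_basis {canonical_elem L A | A :: 'n nmat. True}"
    by (simp add: full_SetCompr_eq)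
qed

end
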